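(* Assume the Setting and Shooting problem below, and that $g$ satisfies (H1) and (H2); let $\beta$ be as in the Setting. Then there exists $\gamma_0>0$ such that for all $\gamma>\gamma_0$, $$y'(T(\gamma),\gamma)=\frac{n}{n-1}\frac{1}{g'}+\frac{n^2\alpha_n g''}{(n-1)(g')^3}+O\!\left(\frac{\delta^2g''}{(g')^4}+\frac{e^{-(g-\frac{n-1}{n}\gamma g')}}{g'}\right),$$ $$T(\gamma)=\Big(g-\tfrac{n-1}{n}\gamma g'\Big)+(n-1)\log\Big(\tfrac{n-1}{n}g'\Big)+\frac{\alpha_n(n-1)\gamma g''}{g'}+O\!\left(\frac{(\log g')^2}{g'}+\frac{(\log g')^{\beta+1}}{(g')^\beta}+e^{-(g-\frac{n-1}{n}\gamma g')}\right).$$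
   Context: Setting: Fix an integer $n\ge2$. Let $f\in C[0,\infty)\cap C^3(0,\infty)$ with $f(u)>0$ for $u>0$, and suppose $f(u)=e^{g(u)}$ for $u>0$, where $g(u)=au^q+\rho(u)$ with $a>0$, $1<q\le\frac{n}{n-1}$, $\rho\in C^3(0,\infty)$. Assume there exist $0<\alpha\le1$ and $\beta>0$ with $f(s)-f(0)=O(s^\beta)$ and $f'(s)=O(s^{\alpha-1})$ as $s\to0^+$. (H1) $\lim_{\gamma\to\infty}\rho^{(k)}(\gamma)/\gamma^{q-k}=0$ for $k=0,1,2,3$; (H2) there is $b\in\mathbb R$ with $\liminf_{\gamma\to\infty}\big(g(\gamma)-\frac{n-1}{n}\gamma g'(\gamma)\big)\ge b$. Shooting problem: for $\gamma>0$, $y(t)=y(t,\gamma)$ is the (increasing) solution of $-((y')^{n-1})'=f(y)e^{-t}$ with $y(t)\to\gamma$, $y'(t)\to0$ as $t\to\infty$, and $T(\gamma)=\inf\{t:\ y(s,\gamma)>0\ \forall s>t\}$ is its first zero. Notation: $g=g(\gamma)$, $g'=g'(\gamma)$, $g''=g''(\gamma)$, $\delta=\log g'(\gamma)$, $\alpha_n=1+\frac12+\dots+\frac1n$. $O(h(\gamma))$ denotes a quantity bounded in absolute value by $Ch(\gamma)$ with $C$ independent of $\gamma>\gamma_0$. *)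

theory Defs
  imports "HOL-Analysis.Analysis" "HOL-Library.Landau_Symbols" "HOL-Library.Liminf_Limsup"
begin

definition Ck_on :: "nat \<Rightarrow> real set \<Rightarrow> (real \<Rightarrow> real) \<Rightarrow> bool" where
  "Ck_on k S h \<longleftrightarrow>
     (\<forall>j<k. \<forall>x\<in>S. ((deriv ^^ j) h) differentiable (at x)) \<and>
     continuous_on S ((deriv ^^ k) h)"

definition shooting_sol ::
  "nat \<Rightarrow> (real \<Rightarrow> real) \<Rightarrow> real \<Rightarrow> (real \<Rightarrow> real) \<Rightarrow> (real \<Rightarrow> real) \<Rightarrow> real \<Rightarrow> bool" where
  "shooting_sol n f \<gamma> y y' T \<longleftrightarrow>
     bdd_below {t. \<forall>s>t. 0 < y s} \<and>
     T = Inf {t. \<forall>s>t. 0 < y s} \<and>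
     isCont y T \<and>
     mono_on {T..} y \<and>
     (\<forall>t\<ge>T. (y has_real_derivative y' t) (at t within {T..})) \<and>
     (\<forall>t\<ge>T. ((\<lambda>s. (y' s) ^ (n - 1)) has_real_derivative (- (f (y t) * exp (- t))))
                (at t within {T..})) \<and>
     (y \<longlongrightarrow> \<gamma>) at_top \<and>
     (y' \<longlongrightarrow> 0) at_top"

end

theory Submission
  imports Defs "HOL-Real_Asymp.Real_Asymp"
begin

text \<open>
  Write \<open>m = n - 1\<close>, \<open>p = y'\<close>, \<open>G = g' \<gamma>\<close>, \<open>F = f y e\<^sup>-\<^sup>t\<close>. The quantity
  \<open>R = p\<^sup>m - (m/n) g'(y) p\<^sup>n - F\<close> satisfies \<open>R' = - (m/n) g''(y) p\<^sup>n p\<close> and tends to \<open>0\<close>, so it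
  measures exactly the deviation from the Liouville equation, where \<open>g'\<close> is constant and \<open>R = 0\<close>.
  While \<open>y\<close> stays within a large multiple of \<open>ln G / G\<close> of \<open>\<gamma>\<close>, this gives \<open>y\<close> and \<open>p\<close> to
  leading order; inserting them in the integral of \<open>R'\<close> and solving the identity for \<open>p\<close> once \<open>F\<close> is
  negligible yields the next order, the harmonic number arising from
  \<open>\<integral>\<^sub>0\<^sup>z (1 - e\<^sup>-\<^sup>u)\<^sup>n du = z - harm n + O(e\<^sup>-\<^sup>z)\<close>.
  Below that level \<open>y\<close> lies under its tangent line, and convexity of \<open>g\<close> bounds \<open>F\<close> on the tangent by
  its values at the two ends, so that \<open>y\<close> is linear up to the admitted error.
\<close>

section \<open>Exact identities along a solution\<close>

text \<open>The data are prescribed at infinity, and no integral is ever formed: a tail estimate is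
  a difference of two functions that tends to \<open>0\<close> and whose derivative has a sign.

  The accuracy needed for the slope shapes the argument. The tangent at the matching time runs for a
  time \<open>y1 / p1\<close> of order \<open>X = \<gamma> g'\<close>, so a relative error in its
  slope is multiplied by \<open>X\<close> in \<open>T\<close>. Comparison with the Liouville profile
  gives the slope only up to a relative error of order \<open>\<kappa>\<close>, about
  \<open>\<epsilon> \<delta>^2\<close>, which swamps the correction of order
  \<open>\<epsilon>\<close> being sought. The slope is therefore read off algebraically from
  \<open>R\<close>, where the coarse bounds enter multiplied by a further small factor; its relative
  error becomes \<open>\<epsilon> \<eta>\<close>, and since \<open>X \<epsilon>\<close> stays
  bounded this costs only \<open>\<eta>\<close> in \<open>T\<close>.

  The matching depth \<open>z = L \<delta>\<close> must be large enough for \<open>F\<close> to stay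
  negligible after multiplication by the square of the outer length, hence
  \<open>exp (- L \<delta>) \<le> X^-4\<close>, and small enough for \<open>g''\<close> to be nearly
  constant above it. Terms containing \<open>L\<close> cancel in both expansions.\<close>

lemma has_derivative_nonneg_le_limit:
  fixes h h' :: "real \<Rightarrow> real"
  assumes "\<And>s. s \<ge> t \<Longrightarrow> (h has_real_derivative h' s) (at s)" "\<And>s. s \<ge> t \<Longrightarrow> h' s \<ge> 0"
    and lim: "(h \<longlongrightarrow> L) at_top"
  shows "h t \<le> L"
proof (rule tendsto_lowerbound[OF lim])
  show "\<forall>\<^sub>F s in at_top. h t \<le> h s"
    using eventually_ge_at_top[of t]
  proof eventually_elim
    case (elim s)
    show ?case
    proof (rule DERIV_nonneg_imp_nondecreasing[OF elim])
      show "\<exists>D. (h has_real_derivative D) (at x) \<and> D \<ge> 0" if "t \<le> x" for x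
        using assms(1,2)[OF that] by (intro exI[of _ "h' x"] conjI)
    qed
  qed
qed simp

lemma has_derivative_nonpos_ge_limit:
  fixes h h' :: "real \<Rightarrow> real"
  assumes "\<And>s. s \<ge> t \<Longrightarrow> (h has_real_derivative h' s) (at s)" "\<And>s. s \<ge> t \<Longrightarrow> h' s \<le> 0"
    and lim: "(h \<longlongrightarrow> L) at_top"
  shows "L \<le> h t"
proof (rule tendsto_upperbound[OF lim])
  show "\<forall>\<^sub>F s in at_top. h s \<le> h t"
    using eventually_ge_at_top[of t]
  proof eventually_elim
    case (elim s)
    show ?case
    proof (rule DERIV_nonpos_imp_nonincreasing[OF elim])
      show "\<exists>D. (h has_real_derivative D) (at x) \<and> D \<le> 0" if "t \<le> x" for x
        using assms(1,2)[OF that] by (intro exI[of _ "h' x"] conjI)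
    qed
  qed
qed simp

locale shooting =
  fixes m :: nat and f g g1 g2 :: "real \<Rightarrow> real" and \<gamma> :: real
    and y p :: "real \<Rightarrow> real" and T :: real
  assumes m_pos: "m > 0" and \<gamma>_pos: "\<gamma> > 0"
    and f_cont: "continuous_on {0..} f"
    and f_exp: "\<And>u. u > 0 \<Longrightarrow> f u = exp (g u)"
    and g_deriv: "\<And>u. u > 0 \<Longrightarrow> (g has_real_derivative g1 u) (at u)"
    and g1_deriv: "\<And>u. u > 0 \<Longrightarrow> (g1 has_real_derivative g2 u) (at u)"
    and sol: "shooting_sol (Suc m) f \<gamma> y p T"
begin

abbreviation n :: nat where "n \<equiv> Suc m"

section \<open>Sign, monotonicity and regularity of \<open>y\<close> and \<open>p\<close> after the
  first zero\<close>

definition F where "F t = f (y t) * exp (- t)"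

lemma y_lim: "(y \<longlongrightarrow> \<gamma>) at_top" and p_lim: "(p \<longlongrightarrow> 0) at_top"
  and y_mono: "mono_on {T..} y"
  and y_deriv_within: "t \<ge> T \<Longrightarrow> (y has_real_derivative p t) (at t within {T..})"
  and Q_deriv_within: "t \<ge> T \<Longrightarrow> ((\<lambda>s. p s ^ m) has_real_derivative - F t) (at t within {T..})"
  using sol by (auto simp: shooting_sol_def F_def)

lemma y_pos: "y t > 0" if "t > T"
proof -
  have "bdd_below {t. \<forall>s>t. 0 < y s}" "T = Inf {t. \<forall>s>t. 0 < y s}"
    using sol by (auto simp: shooting_sol_def)
  moreover have "{t. \<forall>s>t. 0 < y s} \<noteq> {}"
  proof -
    have "\<forall>\<^sub>F s in at_top. y s > 0"
      using order_tendstoD(1)[OF y_lim \<gamma>_pos] .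
    then show ?thesis
      unfolding eventually_at_top_dense by blast
  qed
  ultimately have "\<exists>t'\<in>{t. \<forall>s>t. 0 < y s}. t' < t"
    using that cInf_less_iff[of "{t. \<forall>s>t. 0 < y s}" t] by simp
  then show ?thesis by blast
qed

text \<open>A positive value at \<open>T\<close> would persist slightly to the left, because
  \<open>isCont y T\<close> is two-sided, and the infimum would be smaller than \<open>T\<close>. A
  negative value contradicts the limit from the right.\<close>

lemma y_T: "y T = 0"
proof (rule ccontr)
  have bdd: "bdd_below {t. \<forall>s>t. 0 < y s}" and Inf: "T = Inf {t. \<forall>s>t. 0 < y s}"
    and cont: "isCont y T"
    using sol by (auto simp: shooting_sol_def)
  assume "y T \<noteq> 0"
  moreover have "y T \<ge> 0"
  proof (rule tendsto_lowerbound)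
    show "(y \<longlongrightarrow> y T) (at_right T)"
      using cont by (simp add: isCont_def filterlim_at_split)
    show "\<forall>\<^sub>F s in at_right T. 0 \<le> y s"
      using y_pos by (auto simp: eventually_at_filter less_imp_le)
  qed simp
  ultimately have "y T > 0" by simp
  then have "\<forall>\<^sub>F s in nhds T. y s > 0"
    using cont by (simp add: isCont_def tendsto_at_iff_tendsto_nhds order_tendstoD)
  then obtain e where e: "e > 0" "\<And>s. dist s T < e \<Longrightarrow> y s > 0"
    by (auto simp: eventually_nhds_metric)
  have "y s > 0" if "s > T - e" for s
    using that y_pos[of s] e(2)[of s] by (cases "s > T") (auto simp: dist_real_def)
  then have "T \<le> T - e"
    by (subst Inf) (intro cInf_lower bdd, simp)
  then show False using e by simp
qed

lemma y_nonneg: "t \<ge> T \<Longrightarrow> y t \<ge> 0"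
  using y_pos[of t] y_T by (cases "t = T") simp_all

lemma at_within_atLeast: "t > T \<Longrightarrow> at t within {T..} = at t"
  by (rule at_within_interior) simp

lemma y_deriv: "t > T \<Longrightarrow> (y has_real_derivative p t) (at t)"
  using y_deriv_within[of t] by (simp add: at_within_atLeast)

lemma Q_deriv: "t > T \<Longrightarrow> ((\<lambda>s. p s ^ m) has_real_derivative - F t) (at t)"
  using Q_deriv_within[of t] by (simp add: at_within_atLeast)

lemma cont_y: "continuous_on {T..} y"
  unfolding continuous_on_eq_continuous_within
  by (intro ballI DERIV_continuous) (rule y_deriv_within, simp)

lemma cont_Q: "continuous_on {T..} (\<lambda>s. p s ^ m)"
  unfolding continuous_on_eq_continuous_within
  by (intro ballI DERIV_continuous) (rule Q_deriv_within, simp)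

lemma F_pos: "t > T \<Longrightarrow> F t > 0"
  using y_pos[of t] by (simp add: F_def f_exp)

lemma Q_lim: "((\<lambda>s. p s ^ m) \<longlongrightarrow> 0) at_top"
  using tendsto_power[OF p_lim, of m] unfolding zero_power[OF m_pos] .

lemma Q_strict_antimono: "p t ^ m < p s ^ m" if "T \<le> s" "s < t"
proof (rule DERIV_neg_imp_decreasing_open[of s t])
  show "\<exists>D. ((\<lambda>s. p s ^ m) has_real_derivative D) (at x) \<and> D < 0" if "s < x" for x
    using Q_deriv[of x] F_pos[of x] that \<open>T \<le> s\<close>
    by (intro exI[of _ "- F x"]) auto
  show "continuous_on {s..t} (\<lambda>s. p s ^ m)"
    using that by (intro continuous_on_subset[OF cont_Q]) auto
qed fact

lemma p_nonneg: "p t \<ge> 0" if "t \<ge> T"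
proof -
  have *: "p t \<ge> 0" if "t > T" for t
    by (rule mono_on_imp_deriv_nonneg[OF y_mono y_deriv[OF that]]) (use that in simp)
  have "t + 1 > T" using that by simp
  show ?thesis
  proof (cases "t > T")
    case False
    then have "t = T" using that by simp
    \<comment> \<open>At the endpoint only right difference quotients are available; they are
      nonnegative since \<open>y T = 0\<close> and \<open>y > 0\<close> afterwards.\<close>
    have "(y has_real_derivative p T) (at_right T)"
      using y_deriv_within[of T] by (auto intro: DERIV_subset)
    then have "((\<lambda>s. (y s - y T) / (s - T)) \<longlongrightarrow> p T) (at_right T)"
      by (simp add: has_field_derivative_iff)
    then have "p T \<ge> 0"
    proof (rule tendsto_lowerbound)
      show "\<forall>\<^sub>F s in at_right T. 0 \<le> (y s - y T) / (s - T)"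
        using y_pos y_T by (auto simp: eventually_at_filter less_imp_le)
    qed simp
    then show ?thesis using \<open>t = T\<close> by simp
  qed (use * in auto)
qed

text \<open>\<open>p ^ m\<close> decreases strictly to values that are still nonnegative, so it
  cannot vanish earlier. Every later division by \<open>p\<close> rests on this.\<close>

lemma p_pos: "p t > 0" if "t \<ge> T"
proof -
  have "p (t + 1) ^ m < p t ^ m" "p (t + 1) \<ge> 0"
    using Q_strict_antimono[of t "t + 1"] p_nonneg[of "t+1"] that by auto
  then have "p t ^ m > 0" by (meson le_less_trans zero_le_power)
  then show ?thesis using p_nonneg[OF that] m_pos
    by (cases "p t = 0") (auto simp: power_0_left)
qed

lemma p_antimono: "p t \<le> p s" if "T \<le> s" "s \<le> t"
proof (cases "s = t")
  case False
  then have "p t ^ m < p s ^ m" using that by (intro Q_strict_antimono) auto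
  then show ?thesis using p_nonneg[of s] that by (meson less_imp_le power_less_imp_less_base order_trans)
qed simp

lemma y_less: "y t < \<gamma>" if "t \<ge> T"
proof -
  have "y t < y (t + 1)"
  proof (rule DERIV_pos_imp_increasing_open[of t "t + 1"])
    show "\<exists>D. (y has_real_derivative D) (at x) \<and> D > 0" if "t < x" for x
      using y_deriv[of x] p_pos[of x] that \<open>T \<le> t\<close> by (intro exI[of _ "p x"]) auto
    show "continuous_on {t..t+1} y"
      using that by (intro continuous_on_subset[OF cont_y]) auto
  qed simp
  also have "\<dots> \<le> \<gamma>"
    using has_derivative_nonneg_le_limit[where h = y and h' = p, OF y_deriv p_nonneg y_lim] that
    by simp
  finally show ?thesis .
qed

text \<open>The equation differentiates only \<open>p ^ m\<close>; \<open>p\<close> is recovered as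
  its \<open>m\<close>-th root, which is differentiable because \<open>p > 0\<close>.\<close>

lemma p_deriv: "(p has_real_derivative - F t / (m * p t ^ (m - 1))) (at t)" if "t > T"
proof -
  have "((\<lambda>s. root m (p s ^ m)) has_real_derivative
      inverse (real m * root m (p t ^ m) ^ (m - Suc 0)) * - F t) (at t)"
    by (rule DERIV_chain2[OF DERIV_real_root[OF m_pos] Q_deriv[OF that]])
      (use p_pos[of t] that in simp)
  moreover have "root m (p t ^ m) = p t"
    using m_pos p_nonneg[of t] that by (simp add: real_root_power_cancel)
  ultimately have "((\<lambda>s. root m (p s ^ m)) has_real_derivative - F t / (m * p t ^ (m - 1))) (at t)"
    by (simp add: divide_inverse mult.commute)
  then show ?thesis
  proof (rule has_field_derivative_transform_within_open)
    show "root m (p s ^ m) = p s" if "s \<in> {T<..}" for s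
      using m_pos p_nonneg[of s] that by (simp add: real_root_power_cancel)
  qed (use that in auto)
qed

lemma F_deriv: "(F has_real_derivative (g1 (y t) * p t - 1) * F t) (at t)" if "t > T"
proof -
  have "((\<lambda>s. exp (g (y s)) * exp (- s)) has_real_derivative
     (exp (g (y t)) * (g1 (y t) * p t)) * exp (- t) + (exp (- t) * - 1) * exp (g (y t))) (at t)"
    using DERIV_chain2[OF g_deriv[OF y_pos[OF that]] y_deriv[OF that]]
    by (intro DERIV_mult DERIV_fun_exp derivative_intros) auto
  also have "(exp (g (y t)) * (g1 (y t) * p t)) * exp (- t) + (exp (- t) * - 1) * exp (g (y t))
     = (g1 (y t) * p t - 1) * F t"
    using y_pos[OF that] by (simp add: F_def f_exp algebra_simps)
  finally show ?thesis
    by (rule has_field_derivative_transform_within_open[where S = "{T<..}"])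
      (use that y_pos in \<open>auto simp: F_def f_exp\<close>)
qed

section \<open>Defects \<open>R\<close> and \<open>S\<close> measured against the Liouville
  equation\<close>

definition R where
  "R t = p t ^ m - m / n * g1 (y t) * p t ^ n - F t"

text \<open>The coefficient \<open>m / n\<close> makes all \<open>F\<close> terms cancel:
  \<open>- F\<close> from \<open>p ^ m\<close>, \<open>g1 p F\<close> from \<open>p ^ n\<close> and
  \<open>- (g1 p - 1) F\<close> from \<open>F\<close> add up to zero. Only the term in which
  \<open>g1\<close> is differentiated survives.\<close>

lemma R_deriv: "(R has_real_derivative - (m / n * g2 (y t) * p t ^ n * p t)) (at t)" if "t > T"
proof -
  have pp: "p t > 0" using p_pos that by simp
  have mm: "p t ^ m = p t ^ (m - 1) * p t" using m_pos
    by (cases m) auto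
  have 1: "((\<lambda>s. g1 (y s)) has_real_derivative g2 (y t) * p t) (at t)"
    by (rule DERIV_chain2[OF g1_deriv[OF y_pos[OF that]] y_deriv[OF that]])
  have 2: "((\<lambda>s. p s ^ n) has_real_derivative n * p t ^ m * (- F t / (m * p t ^ (m - 1)))) (at t)"
    using DERIV_power[OF p_deriv[OF that], of n] by (simp add: mult_ac)
  have 3: "n * p t ^ m * (- F t / (m * p t ^ (m - 1))) = - (n / m * p t * F t)"
    using pp m_pos by (simp add: mm field_simps)
  have 4: "m / n * (g2 (y t) * p t * p t ^ n + - (n / m * p t * F t) * g1 (y t))
      = m / n * g2 (y t) * p t ^ n * p t - g1 (y t) * p t * F t"
  proof -
    have "m / n * (n / m * p t * F t) = p t * F t"
      using m_pos by simp
    then show ?thesis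
      by (simp only: distrib_left mult_minus_left mult_minus_right mult.assoc[symmetric])
        (simp only: mult_ac)
  qed
  show ?thesis
    unfolding R_def mult.assoc[of "m / n"]
    by (rule DERIV_cong[OF DERIV_diff[OF DERIV_diff[OF Q_deriv[OF that]
          DERIV_cmult[OF DERIV_mult[OF 1 2[unfolded 3]]]] F_deriv[OF that]]])
      (use 4 in \<open>simp add: algebra_simps\<close>)
qed

lemma g1_lim: "((\<lambda>t. g1 (y t)) \<longlongrightarrow> g1 \<gamma>) at_top"
  by (rule isCont_tendsto_compose[OF DERIV_isCont[OF g1_deriv[OF \<gamma>_pos]] y_lim])

lemma g_lim: "((\<lambda>t. g (y t)) \<longlongrightarrow> g \<gamma>) at_top"
  by (rule isCont_tendsto_compose[OF DERIV_isCont[OF g_deriv[OF \<gamma>_pos]] y_lim])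

lemma f_lim: "((\<lambda>t. f (y t)) \<longlongrightarrow> f \<gamma>) at_top"
proof -
  have "((\<lambda>t. exp (g (y t))) \<longlongrightarrow> exp (g \<gamma>)) at_top"
    by (intro tendsto_intros g_lim)
  moreover have "\<forall>\<^sub>F t in at_top. exp (g (y t)) = f (y t)"
    using eventually_gt_at_top[of T] by eventually_elim (simp add: f_exp y_pos)
  ultimately show ?thesis
    using f_exp[OF \<gamma>_pos] by (simp add: tendsto_cong)
qed

lemma exp_minus_lim: "((\<lambda>t::real. exp (- t)) \<longlongrightarrow> 0) at_top"
  by (rule filterlim_compose[OF exp_at_bot filterlim_uminus_at_bot_at_top])

text \<open>\<open>p ^ m\<close> is the tail of \<open>F\<close>, in which \<open>f (y t)\<close> is
  eventually within \<open>e / 2\<close> of \<open>f \<gamma>\<close>; so it is caught between the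
  multiples \<open>f \<gamma> - e / 2\<close> and \<open>f \<gamma> + e / 2\<close> of
  \<open>exp (- t)\<close>. This normalises \<open>S\<close> at infinity.\<close>

lemma Q_exp_lim: "((\<lambda>t. p t ^ m * exp t) \<longlongrightarrow> f \<gamma>) at_top"
proof (rule tendstoI)
  fix e :: real assume e: "e > 0"
  have "\<forall>\<^sub>F t in at_top. \<bar>f (y t) - f \<gamma>\<bar> < e / 2 \<and> t > T"
    using tendstoD[OF f_lim, of "e / 2"] e
    by (intro eventually_conj eventually_gt_at_top) (simp add: dist_real_def)
  then obtain t0 where t0: "\<And>t. t \<ge> t0 \<Longrightarrow> \<bar>f (y t) - f \<gamma>\<bar> < e / 2 \<and> t > T"
    unfolding eventually_at_top_linorder by blast
  have lim: "((\<lambda>t. c * exp (- t) - p t ^ m) \<longlongrightarrow> 0) at_top" for c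
    using tendsto_diff[OF tendsto_mult[OF tendsto_const exp_minus_lim, of c] Q_lim] by simp
  have deriv: "((\<lambda>t. c * exp (- t) - p t ^ m) has_real_derivative (f (y t) - c) * exp (- t)) (at t)"
    if "t \<ge> t0" for c t
  proof -
    have "((\<lambda>t. c * exp (- t)) has_real_derivative c * (exp (- t) * - 1)) (at t)"
      by (intro DERIV_cmult DERIV_fun_exp derivative_intros)
    from DERIV_diff[OF this Q_deriv] t0[OF that] show ?thesis
      by (simp add: F_def algebra_simps)
  qed
  have *: "\<bar>p t ^ m * exp t - f \<gamma>\<bar> \<le> e / 2" if t: "t \<ge> t0" for t
  proof -
    have b: "f \<gamma> - e / 2 \<le> f (y s)" "f (y s) \<le> f \<gamma> + e / 2" if "s \<ge> t0" for s
      using t0[OF that] by (auto simp: abs_if split: if_splits)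
    have "0 \<le> (f \<gamma> + e / 2) * exp (- t) - p t ^ m"
      by (rule has_derivative_nonpos_ge_limit[OF deriv _ lim])
        (use t b in \<open>auto intro!: mult_nonpos_nonneg\<close>)
    moreover have "(f \<gamma> - e / 2) * exp (- t) - p t ^ m \<le> 0"
      by (rule has_derivative_nonneg_le_limit[OF deriv _ lim]) (use t b in auto)
    ultimately show ?thesis
      by (auto simp: exp_minus field_simps abs_if)
  qed
  show "\<forall>\<^sub>F t in at_top. dist (p t ^ m * exp t) (f \<gamma>) < e"
    using eventually_ge_at_top[of t0]
    by eventually_elim (use * e in \<open>fastforce simp: dist_real_def\<close>)
qed

text \<open>The Liouville solutions satisfy \<open>p\<^sup>m e\<^sup>t e\<^bsup>- (m/n) g(y)\<^esup> = const\<close>; \<open>S\<close> is the logarithmic defect.\<close>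

definition S where
  "S t = g \<gamma> / n + m / n * g (y t) - t - m * ln (p t)"

lemma div_n_add_div_n: "x / n + m / n * x = x"
proof -
  have "x / n + m / n * x = (1 + real m) * x / n" by (simp add: add_divide_distrib ring_distribs)
  then show ?thesis by simp
qed

text \<open>By \<open>Q_exp_lim\<close>, \<open>t + m ln p\<close> tends to
  \<open>g \<gamma>\<close>; the constant \<open>g \<gamma> / n\<close> in \<open>S\<close> is what
  remains of this limit after subtracting \<open>m / n * g \<gamma>\<close>.\<close>

lemma S_lim: "(S \<longlongrightarrow> 0) at_top"
proof -
  have "((\<lambda>t. g \<gamma> / n + m / n * g (y t) - ln (p t ^ m * exp t)) \<longlongrightarrow>
      g \<gamma> / n + m / n * g \<gamma> - ln (f \<gamma>)) at_top"
    using f_exp[OF \<gamma>_pos] by (intro tendsto_intros g_lim Q_exp_lim) auto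
  moreover have "g \<gamma> / n + m / n * g \<gamma> - ln (f \<gamma>) = 0"
    using f_exp[OF \<gamma>_pos] div_n_add_div_n by simp
  moreover have "\<forall>\<^sub>F t in at_top. g \<gamma> / n + m / n * g (y t) - ln (p t ^ m * exp t) = S t"
    using eventually_gt_at_top[of T]
    by eventually_elim (use p_pos in \<open>simp add: S_def ln_mult_pos ln_realpow\<close>)
  ultimately show ?thesis by (simp add: tendsto_cong)
qed

text \<open>Links the two defects: a sign or a bound for \<open>R\<close> integrates to one for
  \<open>S\<close>.\<close>

lemma S_deriv: "(S has_real_derivative - (R t / p t ^ m)) (at t)" if "t > T"
proof -
  have pp: "p t > 0" using p_pos that by simp
  have mm: "p t ^ m = p t ^ (m - 1) * p t" using m_pos
    by (cases m) auto
  have 1: "((\<lambda>s. g (y s)) has_real_derivative g1 (y t) * p t) (at t)"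
    by (rule DERIV_chain2[OF g_deriv[OF y_pos[OF that]] y_deriv[OF that]])
  have 2: "((\<lambda>s. ln (p s)) has_real_derivative - F t / (m * p t ^ m)) (at t)"
    by (rule DERIV_cong[OF DERIV_chain2[OF DERIV_ln[OF pp] p_deriv[OF that]]])
      (use pp in \<open>simp add: mm field_simps\<close>)
  have 3: "0 + m / n * (g1 (y t) * p t) - 1 - m * (- F t / (m * p t ^ m)) = - (R t / p t ^ m)"
    using pp m_pos by (simp add: R_def field_simps del: of_nat_Suc)
  show ?thesis
    unfolding S_def
    by (rule DERIV_cong[OF _ 3], intro DERIV_diff DERIV_add DERIV_const DERIV_cmult 1 2 DERIV_ident)
qed

lemma R_lim: "(R \<longlongrightarrow> 0) at_top"
proof -
  have "(R \<longlongrightarrow> 0 - m / n * g1 \<gamma> * 0 ^ n - f \<gamma> * 0) at_top"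
    unfolding R_def F_def
    by (intro tendsto_intros Q_lim g1_lim p_lim f_lim exp_minus_lim)
  then show ?thesis by simp
qed

lemma y_le: "T \<le> s \<Longrightarrow> s \<le> t \<Longrightarrow> y s \<le> y t"
  using y_mono by (auto simp: mono_on_def)

text \<open>Supplies the matching time at a prescribed height.\<close>

lemma reaches: "\<exists>t>T. y t = v" if "0 < v" "v < \<gamma>"
proof -
  have "\<forall>\<^sub>F t in at_top. v < y t \<and> t > T"
    using order_tendstoD(1)[OF y_lim that(2)] by (intro eventually_conj eventually_gt_at_top)
  then obtain b where b: "v < y b" "b > T"
    unfolding eventually_at_top_linorder by blast
  have "\<exists>t\<ge>T. t \<le> b \<and> y t = v"
    using b that y_T by (intro IVT' continuous_on_subset[OF cont_y]) auto
  then obtain t where "t \<ge> T" "y t = v" by blast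
  then show ?thesis using y_T that by (intro exI[of _ t]) (cases "t = T", auto)
qed

end

section \<open>The solution near its limit\<close>

text \<open>The antiderivative of \<open>(1 - e\<^sup>-\<^sup>x)\<^sup>n\<close> that vanishes at \<open>0\<close>.\<close>

definition J :: "nat \<Rightarrow> real \<Rightarrow> real" where
  "J n x = x - (\<Sum>k=1..n. (1 - exp (- x)) ^ k / k)"

lemma J_deriv: "(J n has_real_derivative (1 - exp (- x)) ^ n) (at x)"
proof -
  have "((\<lambda>x. x - (\<Sum>k=1..n. (1 - exp (- x)) ^ k / real k)) has_real_derivative
      1 - (\<Sum>k=1..n. (1 - exp (- x)) ^ (k - 1) * exp (- x))) (at x)"
    by (auto intro!: derivative_eq_intros sum.cong)
  \<comment> \<open>With \<open>w = 1 - exp (- x)\<close> the factor \<open>exp (- x)\<close> is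
    \<open>1 - w\<close>, so the geometric sum telescopes.\<close>
  also have "(\<Sum>k=1..n. (1 - exp (- x)) ^ (k - 1) * exp (- x)) = 1 - (1 - exp (- x)) ^ n"
    by (induction n) (simp_all add: algebra_simps)
  finally show ?thesis unfolding J_def by simp
qed

text \<open>On the inner range \<open>g2\<close> is pinned from both sides, because the second-order
  term of the slope is needed as a two-sided estimate. \<open>lo_nonneg\<close> is the convexity
  behind the signs of \<open>R\<close> and \<open>S\<close>.\<close>

locale shooting_inner = shooting +
  fixes t1 lo N :: real
  assumes t1: "t1 > T" and lo_nonneg: "lo \<ge> 0"
    and g2_bounds: "\<And>u. y t1 \<le> u \<Longrightarrow> u \<le> \<gamma> \<Longrightarrow> lo \<le> g2 u \<and> g2 u \<le> N"
    and G_pos: "g1 \<gamma> > 0"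
begin

abbreviation G where "G \<equiv> g1 \<gamma>"
abbreviation d where "d t \<equiv> \<gamma> - y t"
text \<open>One small quantity that dominates both the Taylor remainder of \<open>g\<close> on the
  inner range and the defect \<open>S\<close>; the factor \<open>1/2\<close> of the sharp remainder
  is given up.\<close>

definition \<kappa> where "\<kappa> = N * (d t1)\<^sup>2"
abbreviation z where "z t \<equiv> G * d t / n"

lemma y_t1: "y t1 > 0" "y t1 < \<gamma>" using y_pos y_less t1 by auto

lemma N_nonneg: "lo \<le> N" "N \<ge> 0"
proof -
  have "lo \<le> g2 \<gamma> \<and> g2 \<gamma> \<le> N" using y_t1 by (intro g2_bounds) linarith+
  then show "lo \<le> N" "N \<ge> 0" using lo_nonneg by linarith+
qed

lemma g1_taylor: "0 \<le> G - g1 u" "G - g1 u \<le> N * (\<gamma> - u)" if u: "y t1 \<le> u" "u \<le> \<gamma>"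
proof -
  have "0 \<le> G - g1 u \<and> G - g1 u \<le> N * (\<gamma> - u)"
  proof (cases "u = \<gamma>")
    case False
    obtain x where x: "u < x" "x < \<gamma>" "g1 \<gamma> - g1 u = (\<gamma> - u) * g2 x"
    proof (rule exE[OF MVT2[of u \<gamma> g1 g2]])
      show "(g1 has_real_derivative g2 x) (at x)" if "u \<le> x" for x
        using that u y_t1 by (intro g1_deriv) auto
    qed (use u False in auto)
    have "0 \<le> g2 x" "g2 x \<le> N" using g2_bounds[of x] x u lo_nonneg by auto
    then show ?thesis using x u by (auto simp: mult.commute intro!: mult_left_mono)
  qed simp
  then show "0 \<le> G - g1 u" "G - g1 u \<le> N * (\<gamma> - u)" by auto
qed

lemma g_taylor: "g \<gamma> - g u \<le> G * (\<gamma> - u)" "G * (\<gamma> - u) - \<kappa> \<le> g \<gamma> - g u"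
  if u: "y t1 \<le> u" "u \<le> \<gamma>"
proof -
  have "g \<gamma> - g u \<le> G * (\<gamma> - u) \<and> G * (\<gamma> - u) - \<kappa> \<le> g \<gamma> - g u"
  proof (cases "u = \<gamma>")
    case False
    then have "u < \<gamma>" using u by simp
    moreover have "(g has_real_derivative g1 x) (at x)" if "u \<le> x" for x
      using that u y_t1 by (intro g_deriv) linarith
    ultimately obtain x where x: "u < x" "x < \<gamma>" "g \<gamma> - g u = (\<gamma> - u) * g1 x"
      using MVT2[of u \<gamma> g g1] by blast
    have "y t1 \<le> x" "x \<le> \<gamma>" using x u by linarith+
    note * = g1_taylor[OF this]
    have "N * (\<gamma> - x) \<le> N * (\<gamma> - u)" using x N_nonneg by (intro mult_left_mono) linarith+
    with * have "0 \<le> (\<gamma> - u) * (G - g1 x)" "(\<gamma> - u) * (G - g1 x) \<le> (\<gamma> - u) * (N * (\<gamma> - u))"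
      using u by (intro mult_nonneg_nonneg mult_left_mono; linarith)+
    moreover have "(\<gamma> - u) * (N * (\<gamma> - u)) \<le> \<kappa>"
    proof -
      have "(\<gamma> - u)\<^sup>2 \<le> (\<gamma> - y t1)\<^sup>2" using u by (intro power_mono) linarith+
      from mult_left_mono[OF this N_nonneg(2)] show ?thesis
        by (simp only: \<kappa>_def power2_eq_square mult_ac)
    qed
    moreover have "(\<gamma> - u) * (G - g1 x) = G * (\<gamma> - u) - (g \<gamma> - g u)"
      unfolding x(3) by (simp add: algebra_simps)
    ultimately show ?thesis by linarith
  qed (use N_nonneg in \<open>simp add: \<kappa>_def\<close>)
  then show "g \<gamma> - g u \<le> G * (\<gamma> - u)" "G * (\<gamma> - u) - \<kappa> \<le> g \<gamma> - g u" by auto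
qed

lemma inner_range: assumes "t \<ge> t1" shows "t > T" "y t1 \<le> y t" "y t < \<gamma>" "p t > 0"
  using assms t1 y_le[of t1 t] y_less[of t] p_pos[of t] by auto

lemma R_nonneg: "R t \<ge> 0" if "t \<ge> t1"
proof (rule has_derivative_nonpos_ge_limit[OF R_deriv _ R_lim])
  fix s assume "s \<ge> t"
  then have s: "s \<ge> t1" using that by simp
  show "- (m / n * g2 (y s) * p s ^ n * p s) \<le> 0"
    using g2_bounds[of "y s"] inner_range[OF s] lo_nonneg by simp
qed (use inner_range that in auto)

text \<open>A crude first bound: since \<open>p\<close> decreases, the tail integral of
  \<open>p ^ n * p\<close> is at most \<open>p t ^ n\<close> times that of \<open>p\<close>, which
  is \<open>d t\<close>. It is enough to control \<open>S\<close>, on which the sharper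
  \<open>R_bounds\<close> depends.\<close>

lemma R_le: "R t \<le> m / n * N * d t * p t ^ n" if "t \<ge> t1"
proof -
  define U where "U = (\<lambda>t. m / n * N * d t * p t ^ n)"
  define U' where "U' t = m / n * N * (- p t * p t ^ n + n * p t ^ m * (- F t / (m * p t ^ (m - 1))) * d t)" for t
  have "R t - U t \<le> 0"
  proof (rule has_derivative_nonneg_le_limit[where h = "\<lambda>s. R s - U s"])
    fix s assume "s \<ge> t"
    then have s: "s \<ge> t1" using that by simp
    note r = inner_range[OF s]
    have "((\<lambda>s. p s ^ n) has_real_derivative n * p s ^ m * (- F s / (m * p s ^ (m - 1)))) (at s)"
      using DERIV_power[OF p_deriv[OF r(1)], of n] by (simp add: mult_ac)
    then have "(U has_real_derivative U' s) (at s)"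
      unfolding U_def U'_def mult.assoc[of "m / n * N"]
      by (intro DERIV_cmult DERIV_mult) (auto intro!: derivative_eq_intros y_deriv r)
    then show "((\<lambda>s. R s - U s) has_real_derivative
        - (m / n * g2 (y s) * p s ^ n * p s) - U' s) (at s)"
      by (intro DERIV_diff R_deriv r)
    have "g2 (y s) * (p s ^ n * p s) \<le> N * (p s ^ n * p s)"
      using g2_bounds[of "y s"] r by (intro mult_right_mono) auto
    moreover have "n * p s ^ m * (F s / (m * p s ^ (m - 1))) * d s \<ge> 0"
      using r F_pos[of s] by (intro mult_nonneg_nonneg divide_nonneg_nonneg) auto
    then have "N * (n * p s ^ m * (F s / (m * p s ^ (m - 1))) * d s) \<ge> 0"
      by (rule mult_nonneg_nonneg[OF N_nonneg(2)])
    ultimately have "g2 (y s) * (p s ^ n * p s)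
       \<le> N * (p s ^ n * p s) + N * (n * p s ^ m * (F s / (m * p s ^ (m - 1))) * d s)"
      by linarith
    from mult_left_mono[OF this, of "m / n"]
    show "- (m / n * g2 (y s) * p s ^ n * p s) - U' s \<ge> 0"
      by (simp add: U'_def algebra_simps)
  next
    have "((\<lambda>s. R s - U s) \<longlongrightarrow> 0 - m / n * N * (\<gamma> - \<gamma>) * 0 ^ n) at_top"
      unfolding U_def by (intro tendsto_intros R_lim y_lim p_lim)
    then show "((\<lambda>s. R s - U s) \<longlongrightarrow> 0) at_top" by simp
  qed
  then show ?thesis by (simp add: U_def)
qed

lemma S_nonneg: "S t \<ge> 0" if "t \<ge> t1"
proof (rule has_derivative_nonpos_ge_limit[OF S_deriv _ S_lim])
  fix s assume "s \<ge> t"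
  then have s: "s \<ge> t1" using that by simp
  show "- (R s / p s ^ m) \<le> 0" using R_nonneg[OF s] inner_range[OF s] by simp
qed (use inner_range that in auto)

text \<open>By \<open>R_le\<close> the derivative of \<open>S\<close> is at most
  \<open>c * d * p\<close> in size, and \<open>d * p\<close> is the derivative of
  \<open>- d^2 / 2\<close>.\<close>

lemma S_le: "S t \<le> \<kappa>" if "t \<ge> t1"
proof -
  define c where "c = m / n * N"
  have *: "S t - c * (d t)\<^sup>2 / 2 \<le> 0"
  proof (rule has_derivative_nonneg_le_limit[where h = "\<lambda>s. S s - c * (d s)\<^sup>2 / 2"])
    fix s assume "s \<ge> t"
    then have s: "s \<ge> t1" using that by simp
    note r = inner_range[OF s]
    show "((\<lambda>s. S s - c * (d s)\<^sup>2 / 2) has_real_derivative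
        - (R s / p s ^ m) + c * d s * p s) (at s)"
      by (auto intro!: derivative_eq_intros S_deriv y_deriv r simp: field_simps)
    have "R s / p s ^ m \<le> c * d s * p s"
      using R_le[OF s] r by (simp add: c_def divide_le_eq mult_ac)
    then show "- (R s / p s ^ m) + c * d s * p s \<ge> 0" by simp
  next
    have "((\<lambda>s. S s - c * (d s)\<^sup>2 / 2) \<longlongrightarrow> 0 - c * (\<gamma> - \<gamma>)\<^sup>2 / 2) at_top"
      by (intro tendsto_intros S_lim y_lim) auto
    then show "((\<lambda>s. S s - c * (d s)\<^sup>2 / 2) \<longlongrightarrow> 0) at_top" by simp
  qed
  have "S t \<le> c * (d t)\<^sup>2 / 2" using * by simp
  also have "c * (d t)\<^sup>2 / 2 \<le> N * (d t)\<^sup>2"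
  proof -
    have "c \<le> N" using N_nonneg by (auto simp: c_def field_simps)
    then have "c * (d t)\<^sup>2 \<le> N * (d t)\<^sup>2" by (intro mult_right_mono) auto
    moreover have "0 \<le> N * (d t)\<^sup>2" using N_nonneg by simp
    ultimately show ?thesis by linarith
  qed
  also have "\<dots> \<le> \<kappa>"
    using inner_range[OF that] N_nonneg unfolding \<kappa>_def
    by (intro mult_left_mono power_mono) auto
  finally show ?thesis by simp
qed

section \<open>Leading-order profile of \<open>p\<close> and of time in the variable
  \<open>z\<close>\<close>

definition P0 where "P0 = n / (m * G)"
abbreviation w where "w t \<equiv> 1 - exp (- z t)"
definition D where "D t = g \<gamma> - g (y t)"

lemma \<kappa>_nonneg: "\<kappa> \<ge> 0" using N_nonneg by (simp add: \<kappa>_def)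

lemma ln_p: "m * ln (p t) = g \<gamma> - t - m / n * D t - S t"
proof -
  have "m * ln (p t) = g \<gamma> / n + m / n * g \<gamma> - t - m / n * D t - S t"
    by (simp add: S_def D_def ring_distribs)
  then show ?thesis unfolding div_n_add_div_n .
qed

text \<open>Separation of variables: the left side depends on \<open>t\<close> alone, the right side
  is \<open>y'\<close> times a factor that is \<open>exp (z t)\<close> up to
  \<open>exp \<kappa>\<close> either way.\<close>

lemma p_eq: "exp ((g \<gamma> - t) / m) = p t * exp (D t / n + S t / m)" if "t \<ge> t1"
proof -
  have "(g \<gamma> - t) / m = ln (p t) + (D t / n + S t / m)"
  proof -
    have "ln (p t) = (m * ln (p t)) / m" using m_pos by simp
    also have "\<dots> = (g \<gamma> - t) / m - D t / n - S t / m"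
      using m_pos unfolding ln_p by (simp add: diff_divide_distrib del: of_nat_Suc)
    finally show ?thesis by simp
  qed
  then show ?thesis using inner_range[OF that] by (simp only: exp_add exp_ln)
qed

lemma F_eq: "F t = p t ^ m * exp (- D t / n + S t)" if "t \<ge> t1"
proof -
  have *: "m / n * D t = D t - D t / n" using div_n_add_div_n[of "D t"] by linarith
  have "F t = exp (g (y t) - t)"
    using y_pos[OF inner_range(1)[OF that]] by (simp add: F_def f_exp exp_diff exp_minus field_simps)
  also have "g (y t) - t = m * ln (p t) + (- D t / n + S t)"
    using ln_p[of t] D_def[of t] unfolding * minus_divide_left[symmetric] by linarith
  also have "exp \<dots> = p t ^ m * exp (- D t / n + S t)"
    unfolding exp_add using inner_range[OF that] by (simp add: exp_of_nat_mult)
  finally show ?thesis .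
qed

lemma D_bounds: "D t / n \<le> z t" "z t - \<kappa> \<le> D t / n" if "t \<ge> t1"
proof -
  have "D t \<le> G * d t" "G * d t - \<kappa> \<le> D t" using g_taylor[of "y t"] inner_range[OF that] by (auto simp: D_def)
  then have "D t / n \<le> z t" "(G * d t - \<kappa>) / n \<le> D t / n"
    by (intro divide_right_mono; simp)+
  moreover have "\<kappa> / n \<le> \<kappa>" using \<kappa>_nonneg by (simp add: field_simps)
  ultimately show "D t / n \<le> z t" "z t - \<kappa> \<le> D t / n"
    unfolding diff_divide_distrib by linarith+
qed

lemma DS_bounds: "D t / n + S t / m \<le> z t + \<kappa>" "z t - \<kappa> \<le> D t / n + S t / m"
  if "t \<ge> t1"
proof -
  have "S t / m \<ge> 0" using S_nonneg[OF that] by simp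
  moreover have "S t / m \<le> S t / 1"
    using S_nonneg[OF that] m_pos by (intro divide_left_mono) auto
  ultimately show "D t / n + S t / m \<le> z t + \<kappa>" "z t - \<kappa> \<le> D t / n + S t / m"
    using D_bounds[OF that] S_le[OF that] unfolding div_by_1 by linarith+
qed

lemma F_le: "F t \<le> p t ^ m * exp (- z t + 2 * \<kappa>)" if "t \<ge> t1"
  unfolding F_eq[OF that]
proof (intro mult_left_mono)
  have "- D t / n + S t \<le> - z t + 2 * \<kappa>"
    using D_bounds[OF that] S_le[OF that] unfolding minus_divide_left[symmetric] by linarith
  then show "exp (- D t / n + S t) \<le> exp (- z t + 2 * \<kappa>)" by (simp only: exp_le_cancel_iff)
qed (use inner_range[OF that] in simp)

text \<open>\<open>V\<close> is the tail integral of the left side of \<open>p_eq\<close>, and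
  \<open>B\<close> is that of \<open>p * exp z\<close>, the approximate right side.\<close>

definition V where "V t = m * exp ((g \<gamma> - t) / m)"
definition B where "B t = n / G * (exp (z t) - 1)"

lemma V_deriv: "(V has_real_derivative - exp ((g \<gamma> - t) / m)) (at t)"
  unfolding V_def using m_pos by (auto intro!: derivative_eq_intros)

lemma B_deriv: "(B has_real_derivative - p t * exp (z t)) (at t)" if "t > T"
  unfolding B_def using G_pos
  by (auto intro!: derivative_eq_intros y_deriv[OF that] simp del: of_nat_Suc)

lemma V_lim: "(V \<longlongrightarrow> 0) at_top"
proof -
  have "((\<lambda>t. m * exp ((g \<gamma> - t) / m)) \<longlongrightarrow> 0) at_top"
    using m_pos by real_asymp
  then show ?thesis by (simp only: V_def[abs_def])
qed

lemma z_lim: "(z \<longlongrightarrow> 0) at_top"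
proof -
  have "(z \<longlongrightarrow> G * (\<gamma> - \<gamma>) / n) at_top"
    by (intro tendsto_intros y_lim) simp
  then show ?thesis by simp
qed

lemma B_lim: "(B \<longlongrightarrow> 0) at_top"
proof -
  have "(B \<longlongrightarrow> n / G * (exp 0 - 1)) at_top"
    unfolding B_def by (intro tendsto_intros z_lim)
  then show ?thesis by simp
qed

lemma V_bounds: "V t \<le> exp \<kappa> * B t" "exp (- \<kappa>) * B t \<le> V t" if "t \<ge> t1"
proof -
  have lim: "((\<lambda>t. V t - c * B t) \<longlongrightarrow> 0) at_top" for c
    using tendsto_diff[OF V_lim tendsto_mult[OF tendsto_const B_lim, of c]] by simp
  have deriv: "((\<lambda>t. V t - c * B t) has_real_derivative
      p s * (c * exp (z s) - exp (D s / n + S s / m))) (at s)" if "s \<ge> t1" for c s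
    by (rule DERIV_cong[OF DERIV_diff[OF V_deriv DERIV_cmult[OF B_deriv]]])
      (use inner_range[OF that] p_eq[OF that] in \<open>simp_all add: algebra_simps del: of_nat_Suc\<close>)
  have *: "exp (D s / n + S s / m) \<le> exp \<kappa> * exp (z s)"
       "exp (- \<kappa>) * exp (z s) \<le> exp (D s / n + S s / m)" if "s \<ge> t1" for s
    using DS_bounds[OF that] by (simp_all add: exp_add[symmetric] add.commute del: of_nat_Suc)
  have "V t - exp \<kappa> * B t \<le> 0"
    by (rule has_derivative_nonneg_le_limit[OF deriv _ lim])
      (use that * in \<open>auto intro!: mult_nonneg_nonneg less_imp_le[OF inner_range(4)] simp del: of_nat_Suc\<close>)
  moreover have "V t - exp (- \<kappa>) * B t \<ge> 0"
    by (rule has_derivative_nonpos_ge_limit[OF deriv _ lim])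
      (use that * in \<open>auto intro!: mult_nonneg_nonpos less_imp_le[OF inner_range(4)] simp del: of_nat_Suc\<close>)
  ultimately show "V t \<le> exp \<kappa> * B t" "exp (- \<kappa>) * B t \<le> V t" by auto
qed

text \<open>If \<open>g1\<close> were constantly \<open>G\<close>, then
  \<open>F = p ^ m * exp (- z)\<close>, and \<open>R = 0\<close> would give exactly
  \<open>p = P0 * w\<close>. The exponent \<open>2 * \<kappa>\<close> collects one
  \<open>\<kappa>\<close> from replacing \<open>V\<close> by \<open>B\<close> and one from replacing
  \<open>D / n + S / m\<close> by \<open>z\<close>.\<close>

lemma p_bounds: "p t \<le> P0 * w t * exp (2 * \<kappa>)" "P0 * w t * exp (- 2 * \<kappa>) \<le> p t"
  if "t \<ge> t1"
proof -
  define x where "x = D t / n + S t / m"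
  have p: "p t = V t / m * exp (- x)"
  proof -
    have "V t / m = p t * exp x" using p_eq[OF that] m_pos by (simp add: V_def x_def)
    then show ?thesis by (simp add: exp_minus)
  qed
  have B: "B t / m * exp (- z t) = P0 * w t"
    by (simp add: B_def P0_def exp_minus field_simps del: of_nat_Suc)
  have "z t \<ge> 0" using G_pos inner_range[OF that] by simp
  then have "B t \<ge> 0" using G_pos by (simp add: B_def del: of_nat_Suc)
  have "V t / m * exp (- x) \<le> (exp \<kappa> * B t) / m * exp (- z t + \<kappa>)"
    using V_bounds[OF that] DS_bounds[OF that] \<open>B t \<ge> 0\<close>
    by (intro mult_mono divide_right_mono) (auto simp: x_def V_def simp del: of_nat_Suc)
  also have "\<dots> = (B t / m * exp (- z t)) * exp (2 * \<kappa>)"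
    by (simp add: exp_add mult_exp_exp field_simps flip: mult_2)
  finally show "p t \<le> P0 * w t * exp (2 * \<kappa>)" unfolding p B .
  have "(exp (- \<kappa>) * B t) / m * exp (- z t - \<kappa>) \<le> V t / m * exp (- x)"
    using V_bounds[OF that] DS_bounds[OF that] \<open>B t \<ge> 0\<close>
    by (intro mult_mono divide_right_mono) (auto simp: x_def V_def simp del: of_nat_Suc)
  moreover have "(exp (- \<kappa>) * B t) / m * exp (- z t - \<kappa>) = (B t / m * exp (- z t)) * exp (- 2 * \<kappa>)"
  proof -
    have "exp (- \<kappa>) * exp (- z t - \<kappa>) = exp (- z t) * exp (- 2 * \<kappa>)"
      by (simp only: mult_exp_exp) (simp del: of_nat_Suc)
    then show ?thesis by (simp add: mult_ac)
  qed
  ultimately show "P0 * w t * exp (- 2 * \<kappa>) \<le> p t" unfolding p B by simp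
qed

lemma w_nonneg: "w t \<ge> 0" if "t \<ge> t1"
  using G_pos inner_range[OF that] by simp

lemma P0_pos: "P0 > 0" using G_pos m_pos by (simp add: P0_def)

lemma p_power_bounds: "p t ^ k \<le> P0 ^ k * exp (2 * real k * \<kappa>) * w t ^ k"
    "P0 ^ k * exp (- 2 * real k * \<kappa>) * w t ^ k \<le> p t ^ k" if "t \<ge> t1"
proof -
  have e: "exp (2 * real k * \<kappa>) = exp (2 * \<kappa>) ^ k" "exp (- 2 * real k * \<kappa>) = exp (- 2 * \<kappa>) ^ k"
    by (simp_all add: exp_of_nat_mult[symmetric] mult_ac)
  have "p t ^ k \<le> (P0 * w t * exp (2 * \<kappa>)) ^ k"
    using p_bounds[OF that] inner_range[OF that] by (intro power_mono) auto
  then show "p t ^ k \<le> P0 ^ k * exp (2 * real k * \<kappa>) * w t ^ k"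
    unfolding e by (simp add: power_mult_distrib mult_ac)
  have "(P0 * w t * exp (- 2 * \<kappa>)) ^ k \<le> p t ^ k"
    using p_bounds[OF that] w_nonneg[OF that] P0_pos by (intro power_mono mult_nonneg_nonneg) auto
  then show "P0 ^ k * exp (- 2 * real k * \<kappa>) * w t ^ k \<le> p t ^ k"
    unfolding e by (simp add: power_mult_distrib mult_ac)
qed

section \<open>The defect \<open>R\<close> to its leading order\<close>

definition K where "K = m * P0 ^ n / G"

text \<open>In the variable \<open>z\<close>, where \<open>p dt = - (n / G) dz\<close>, the
  derivative of \<open>R\<close> is \<open>(m / G) * g2 * p ^ n\<close>, approximately
  \<open>g2 * K * w ^ n\<close>; integrating from \<open>z = 0\<close> produces \<open>J\<close>.
  The exponential factors come from the bounds on \<open>p ^ n\<close>.\<close>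

lemma R_bounds: "R t \<le> N * K * exp (2 * real n * \<kappa>) * J n (z t)"
    "lo * K * exp (- 2 * real n * \<kappa>) * J n (z t) \<le> R t" if "t \<ge> t1"
proof -
  have J: "((\<lambda>s. J n (z s)) has_real_derivative w s ^ n * (- G * p s / n)) (at s)" if "s \<ge> t1" for s
  proof (rule DERIV_chain2[OF J_deriv])
    show "(z has_real_derivative - G * p s / n) (at s)"
      by (auto intro!: derivative_eq_intros y_deriv inner_range[OF that] simp del: of_nat_Suc)
  qed
  have deriv: "((\<lambda>s. R s - c * K * J n (z s)) has_real_derivative
      (m / n * p s) * (c * (P0 ^ n * w s ^ n) - g2 (y s) * p s ^ n)) (at s)" if "s \<ge> t1" for c s
    by (rule DERIV_cong[OF DERIV_diff[OF R_deriv DERIV_cmult[OF J]]])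
      (use inner_range[OF that] that G_pos in \<open>auto simp: K_def field_simps simp del: of_nat_Suc\<close>)
  have lim: "((\<lambda>s. R s - c * K * J n (z s)) \<longlongrightarrow> 0) at_top" for c
  proof -
    have "((\<lambda>s. R s - c * K * J n (z s)) \<longlongrightarrow> 0 - c * K * J n 0) at_top"
      by (intro tendsto_intros R_lim isCont_tendsto_compose[OF DERIV_isCont[OF J_deriv] z_lim])
    moreover have "J n 0 = 0" by (simp add: J_def zero_power)
    ultimately show ?thesis by simp
  qed
  have "R t - (N * exp (2 * real n * \<kappa>)) * K * J n (z t) \<le> 0"
  proof (rule has_derivative_nonneg_le_limit[OF deriv _ lim])
    fix s assume "s \<ge> t"
    then have s: "s \<ge> t1" using that by simp
    have "g2 (y s) * p s ^ n \<le> N * (P0 ^ n * exp (2 * real n * \<kappa>) * w s ^ n)"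
      using g2_bounds[of "y s"] inner_range[OF s] N_nonneg
      by (intro mult_mono p_power_bounds s) (auto simp del: power_Suc)
    then have "N * exp (2 * real n * \<kappa>) * (P0 ^ n * w s ^ n) - g2 (y s) * p s ^ n \<ge> 0"
      by (simp add: mult_ac del: of_nat_Suc power_Suc)
    then show "(m / n * p s) * (N * exp (2 * real n * \<kappa>) * (P0 ^ n * w s ^ n) - g2 (y s) * p s ^ n) \<ge> 0"
      using inner_range[OF s] by (intro mult_nonneg_nonneg) auto
  qed (use that in auto)
  then show "R t \<le> N * K * exp (2 * real n * \<kappa>) * J n (z t)" by (simp add: mult_ac del: of_nat_Suc power_Suc)
  have "R t - (lo * exp (- 2 * real n * \<kappa>)) * K * J n (z t) \<ge> 0"
  proof (rule has_derivative_nonpos_ge_limit[OF deriv _ lim])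
    fix s assume "s \<ge> t"
    then have s: "s \<ge> t1" using that by simp
    have "lo * (P0 ^ n * exp (- 2 * real n * \<kappa>) * w s ^ n) \<le> g2 (y s) * p s ^ n"
      using g2_bounds[of "y s"] inner_range[OF s] lo_nonneg P0_pos w_nonneg[OF s]
      by (intro mult_mono p_power_bounds s) (auto simp del: power_Suc)
    then have "lo * exp (- 2 * real n * \<kappa>) * (P0 ^ n * w s ^ n) - g2 (y s) * p s ^ n \<le> 0"
      by (simp add: mult_ac del: of_nat_Suc power_Suc)
    then show "(m / n * p s) * (lo * exp (- 2 * real n * \<kappa>) * (P0 ^ n * w s ^ n) - g2 (y s) * p s ^ n) \<le> 0"
      using inner_range[OF s] by (intro mult_nonneg_nonpos) auto
  qed (use that in auto)
  then show "lo * K * exp (- 2 * real n * \<kappa>) * J n (z t) \<le> R t" by (simp add: mult_ac del: of_nat_Suc power_Suc)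
qed

text \<open>The denominator is estimated in the direction opposite to the numerator, so the
  exponents \<open>n\<close> and \<open>m\<close> add up.\<close>

lemma R_div_bounds:
  "R t / p t ^ m \<le> N * (n / G\<^sup>2) * exp (2 * (real n + real m) * \<kappa>) * (J n (z t) / w t ^ m)"
  "lo * (n / G\<^sup>2) * exp (- 2 * (real n + real m) * \<kappa>) * (J n (z t) / w t ^ m) \<le> R t / p t ^ m"
  if "t \<ge> t1"
proof -
  have w: "w t > 0" using G_pos inner_range[OF that] by simp
  have K: "K / P0 ^ m = n / G\<^sup>2"
    using P0_pos G_pos m_pos by (simp add: K_def P0_def power2_eq_square field_simps del: of_nat_Suc)
  have e: "exp (2 * real n * \<kappa>) / exp (- 2 * real m * \<kappa>) = exp (2 * (real n + real m) * \<kappa>)"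
      "exp (- 2 * real n * \<kappa>) / exp (2 * real m * \<kappa>) = exp (- 2 * (real n + real m) * \<kappa>)"
    by (simp_all only: exp_diff[symmetric]) (simp_all add: algebra_simps del: of_nat_Suc)
  have "R t / p t ^ m \<le> R t / (P0 ^ m * exp (- 2 * real m * \<kappa>) * w t ^ m)"
    using w P0_pos R_nonneg[OF that] inner_range[OF that]
    by (intro divide_left_mono p_power_bounds that) auto
  also have "\<dots> \<le> (N * K * exp (2 * real n * \<kappa>) * J n (z t)) / (P0 ^ m * exp (- 2 * real m * \<kappa>) * w t ^ m)"
    using w P0_pos by (intro divide_right_mono R_bounds that) auto
  also have "\<dots> = N * (K / P0 ^ m) * (exp (2 * real n * \<kappa>) / exp (- 2 * real m * \<kappa>)) * (J n (z t) / w t ^ m)"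
    by simp
  finally show "R t / p t ^ m \<le> N * (n / G\<^sup>2) * exp (2 * (real n + real m) * \<kappa>) * (J n (z t) / w t ^ m)"
    unfolding K e .
  have "lo * (K / P0 ^ m) * (exp (- 2 * real n * \<kappa>) / exp (2 * real m * \<kappa>)) * (J n (z t) / w t ^ m)
     = (lo * K * exp (- 2 * real n * \<kappa>) * J n (z t)) / (P0 ^ m * exp (2 * real m * \<kappa>) * w t ^ m)"
    by simp
  also have "\<dots> \<le> R t / (P0 ^ m * exp (2 * real m * \<kappa>) * w t ^ m)"
    using w P0_pos by (intro divide_right_mono R_bounds that) auto
  also have "\<dots> \<le> R t / p t ^ m"
    using w P0_pos R_nonneg[OF that] inner_range[OF that]
    by (intro divide_left_mono p_power_bounds that) auto
  finally show "lo * (n / G\<^sup>2) * exp (- 2 * (real n + real m) * \<kappa>) * (J n (z t) / w t ^ m) \<le> R t / p t ^ m"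
    unfolding K e .
qed

text \<open>Taking logarithms in \<open>V_bounds\<close> solves for \<open>t\<close>: up to
  \<open>\<kappa>\<close>, \<open>(g \<gamma> - t) / m\<close> is \<open>ln P0 + z + ln w\<close>,
  and \<open>exp (- z) \<le> 1 / 2\<close> keeps \<open>ln w\<close> within
  \<open>2 * exp (- z)\<close> of zero.\<close>

lemma t_approx:
  assumes "t \<ge> t1" "exp (- z t) \<le> 1 / 2"
  shows "\<bar>t - (g \<gamma> - m * ln P0 - m * z t)\<bar> \<le> m * (\<kappa> + 2 * exp (- z t))"
proof -
  have w: "w t > 0" using assms(2) by linarith
  have "B t = m * (P0 * exp (z t) * w t)"
  proof -
    have "exp (z t) * w t = exp (z t) - 1" by (simp add: right_diff_distrib exp_minus)
    then show ?thesis using m_pos by (simp add: B_def P0_def mult.assoc del: of_nat_Suc)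
  qed
  then have "exp ((g \<gamma> - t) / m) \<le> exp \<kappa> * (P0 * exp (z t) * w t)"
     "exp (- \<kappa>) * (P0 * exp (z t) * w t) \<le> exp ((g \<gamma> - t) / m)"
    using V_bounds[OF assms(1)] m_pos by (simp_all add: V_def del: of_nat_Suc)
  moreover have "exp c * (P0 * exp (z t) * w t) = exp (c + (ln P0 + z t + ln (w t)))" for c
    using P0_pos w by (simp only: exp_add exp_ln)
  ultimately have *: "(g \<gamma> - t) / m \<le> \<kappa> + (ln P0 + z t + ln (w t))"
     "- \<kappa> + (ln P0 + z t + ln (w t)) \<le> (g \<gamma> - t) / m"
    by (simp_all only: exp_le_cancel_iff)
  have "ln (w t) \<le> 0" using w by simp
  moreover have "ln (w t) \<ge> - 2 * exp (- z t)"
  proof -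
    have "ln (1 - exp (- z t)) \<ge> - exp (- z t) - 2 * (exp (- z t))\<^sup>2"
      using assms(2) by (intro ln_one_minus_pos_lower_bound) auto
    moreover have "2 * (exp (- z t))\<^sup>2 \<le> exp (- z t)"
      using assms(2) by (simp add: power2_eq_square)
    ultimately show ?thesis by linarith
  qed
  ultimately have "\<bar>(g \<gamma> - t) / m - ln P0 - z t\<bar> \<le> \<kappa> + 2 * exp (- z t)"
    using * by linarith
  then have "m * \<bar>(g \<gamma> - t) / m - ln P0 - z t\<bar> \<le> m * (\<kappa> + 2 * exp (- z t))"
    by (intro mult_left_mono) auto
  also have "m * \<bar>(g \<gamma> - t) / m - ln P0 - z t\<bar> = \<bar>m * ((g \<gamma> - t) / m - ln P0 - z t)\<bar>"
    by (simp add: abs_mult)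
  also have "m * ((g \<gamma> - t) / m - ln P0 - z t) = - (t - (g \<gamma> - m * ln P0 - m * z t))"
  proof -
    have "m * ((g \<gamma> - t) / m) = g \<gamma> - t" using m_pos by simp
    then show ?thesis unfolding right_diff_distrib by linarith
  qed
  finally show ?thesis by (simp only: abs_minus_cancel)
qed

end

section \<open>The solution down to its zero\<close>

text \<open>Above \<open>u0\<close> the function \<open>g\<close> is increasing and convex; below
  \<open>u0\<close> only the bound \<open>M0\<close> on \<open>f\<close> is available, so the two
  height ranges are estimated differently.\<close>

locale shooting_outer = shooting +
  fixes t1 u0 M0 :: real
  assumes t1: "t1 > T" and u0: "u0 > 0" "u0 \<le> y t1"
    and g1_nonneg: "\<And>u. u \<ge> u0 \<Longrightarrow> g1 u \<ge> 0"
    and g2_nonneg: "\<And>u. u \<ge> u0 \<Longrightarrow> g2 u \<ge> 0"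
    and f_le: "\<And>u. 0 \<le> u \<Longrightarrow> u \<le> u0 \<Longrightarrow> f u \<le> M0"
begin

abbreviation p1 where "p1 \<equiv> p t1"
abbreviation y1 where "y1 \<equiv> y t1"
text \<open>\<open>Tl\<close> is the zero of the tangent line at \<open>t1\<close>.\<close>

definition Tl where "Tl = t1 - y1 / p1"
text \<open>The tangent line has height \<open>u0\<close> at time \<open>Tl + u0 / p1\<close>, so
  \<open>A\<close> is the sum of the values of \<open>f u * exp (- s)\<close> at the two ends of the
  tangent segment between heights \<open>u0\<close> and \<open>y1\<close>.\<close>

definition A where "A = F t1 + f u0 * exp (- (Tl + u0 / p1))"

lemma p1_pos: "p1 > 0" using p_pos t1 by simp

lemma M0_nonneg: "M0 \<ge> 0"
  using f_le[of u0] f_exp[OF u0(1)] u0 exp_gt_zero[of "g u0"] by linarith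

lemma A_nonneg: "A \<ge> 0"
  using F_pos[OF t1] f_exp[OF u0(1)] by (simp add: A_def)

text \<open>\<open>p\<close> is decreasing, so \<open>y\<close> is concave and stays below its
  tangent at \<open>t1\<close>.\<close>

lemma tangent_bound: "y s \<le> y1 - p1 * (t1 - s)" if "T \<le> s" "s \<le> t1"
proof -
  have "y s - p1 * s \<le> y1 - p1 * t1"
  proof (rule DERIV_nonneg_imp_increasing_open[of s t1 "\<lambda>s. y s - p1 * s"])
    show "\<exists>D. ((\<lambda>s. y s - p1 * s) has_real_derivative D) (at x) \<and> D \<ge> 0" if "s < x" "x < t1" for x
      using that \<open>T \<le> s\<close> p_antimono[of x t1]
      by (intro exI[of _ "p x - p1"] conjI) (auto intro!: derivative_eq_intros y_deriv)
    show "continuous_on {s..t1} (\<lambda>s. y s - p1 * s)"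
      using that by (intro continuous_intros continuous_on_subset[OF cont_y]) auto
  qed (use that in simp)
  then show ?thesis by (simp add: algebra_simps)
qed

lemma Tl_le: "Tl \<le> T"
  using tangent_bound[of T] y_T t1 p1_pos by (simp add: Tl_def field_simps)

lemma F_outer: "F s \<le> A + M0 * exp (- s)" if s: "T \<le> s" "s \<le> t1"
proof (cases "y s \<le> u0")
  case True
  then have "f (y s) \<le> M0" using f_le y_nonneg[OF s(1)] by simp
  then show ?thesis using A_nonneg by (simp add: F_def add_increasing)
next
  case False
  define l where "l = y1 - p1 * (t1 - s)"
  have l: "u0 < l" "y s \<le> l" "l \<le> y1"
    using tangent_bound[OF s] False p1_pos s by (auto simp: l_def)
  \<comment> \<open>The tangent line is affine, so height \<open>l\<close> and time \<open>s\<close>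
    are convex combinations of their end values with the same weight \<open>x\<close>; convexity of
    \<open>g\<close> then bounds \<open>g l - s\<close> by the larger end value.\<close>
  define x where "x = (l - u0) / (y1 - u0)"
  have x: "0 \<le> x" "x \<le> 1" using l by (auto simp: x_def)
  have "x * (y1 - u0) = l - u0" using l by (simp add: x_def)
  then have lx: "l = (1 - x) * u0 + x * y1" by (simp add: algebra_simps)
  have sx: "s = (1 - x) * (Tl + u0 / p1) + x * t1"
  proof -
    have "s = t1 - (y1 - l) / p1" using p1_pos by (simp add: l_def)
    also have "y1 - l = (1 - x) * (y1 - u0)" unfolding lx by (simp add: algebra_simps)
    also have "t1 - (1 - x) * (y1 - u0) / p1 = t1 - (1 - x) * (y1 / p1 - u0 / p1)"
      by (simp only: diff_divide_distrib times_divide_eq_right[symmetric])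
    finally show ?thesis unfolding Tl_def by algebra
  qed
  have "convex_on {u0..} g"
    by (rule f''_ge0_imp_convex) (use u0 g2_nonneg in \<open>auto intro!: g_deriv g1_deriv\<close>)
  from convex_onD[OF this x(1,2), of u0 y1] u0 have "g l \<le> (1 - x) * g u0 + x * g y1"
    unfolding lx by (simp add: mult.commute)
  moreover have "g (y s) \<le> g l"
  proof (rule DERIV_nonneg_imp_nondecreasing[OF l(2)])
    show "\<exists>D. (g has_real_derivative D) (at x) \<and> D \<ge> 0" if "y s \<le> x" for x
      using that False u0 g1_nonneg[of x] by (intro exI[of _ "g1 x"] conjI g_deriv) auto
  qed
  ultimately have "g (y s) - s \<le> (1 - x) * (g u0 - (Tl + u0 / p1)) + x * (g y1 - t1)"
    unfolding right_diff_distrib using sx by linarith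
  also have "\<dots> \<le> max (g u0 - (Tl + u0 / p1)) (g y1 - t1)"
    using x by (intro convex_bound_le) auto
  finally have "exp (g (y s) - s) \<le> exp (max (g u0 - (Tl + u0 / p1)) (g y1 - t1))" by simp
  also have "\<dots> \<le> exp (g u0 - (Tl + u0 / p1)) + exp (g y1 - t1)"
    by (simp add: max_def)
  also have "\<dots> = A"
    unfolding A_def F_def f_exp[OF u0(1)] f_exp[OF y_pos[OF t1]] mult_exp_exp by simp
  finally have "F s \<le> A"
    using f_exp[of "y s"] False u0 by (simp add: F_def mult_exp_exp)
  then show ?thesis using M0_nonneg by (simp add: add_increasing2)
qed

lemma L_le: "t1 - T \<le> y1 / p1"
  using Tl_le by (simp add: Tl_def)

lemma p_outer: "p s \<le> p1 + (A * (t1 - T) + M0 * exp (- s)) / p1 ^ (m - 1)" if s: "T \<le> s" "s \<le> t1"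
proof -
  have mm: "x ^ m = x * x ^ (m - 1)" for x :: real using m_pos by (cases m) auto
  have "p s ^ m + A * s - M0 * exp (- s) \<le> p1 ^ m + A * t1 - M0 * exp (- t1)"
  proof (rule DERIV_nonneg_imp_increasing_open[of s t1 "\<lambda>s. p s ^ m + A * s - M0 * exp (- s)"])
    show "\<exists>D. ((\<lambda>s. p s ^ m + A * s - M0 * exp (- s)) has_real_derivative D) (at x) \<and> D \<ge> 0"
      if x: "s < x" "x < t1" for x
    proof (intro exI conjI)
      show "((\<lambda>s. p s ^ m + A * s - M0 * exp (- s)) has_real_derivative
          - F x + A * 1 - M0 * (exp (- x) * - 1)) (at x)"
        using x s by (intro DERIV_diff DERIV_add DERIV_cmult DERIV_ident Q_deriv
            DERIV_fun_exp derivative_intros) auto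
    qed (use F_outer[of x] x s in auto)
    show "continuous_on {s..t1} (\<lambda>s. p s ^ m + A * s - M0 * exp (- s))"
      using s by (intro continuous_intros continuous_on_subset[OF cont_Q]) auto
  qed fact
  moreover have "A * (t1 - s) \<le> A * (t1 - T)" using A_nonneg s by (intro mult_left_mono) auto
  moreover have "M0 * exp (- t1) \<ge> 0" using M0_nonneg by simp
  ultimately have "p s ^ m - p1 ^ m \<le> A * (t1 - T) + M0 * exp (- s)"
    by (simp add: algebra_simps)
  \<comment> \<open>Because \<open>p1 \<le> p s\<close>, the difference
    \<open>p s ^ m - p1 ^ m\<close> is at least \<open>(p s - p1) * p1 ^ (m - 1)\<close>, so no root
    has to be taken.\<close>
  moreover have "p s * p1 ^ (m - 1) \<le> p s * p s ^ (m - 1)"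
    using p_antimono[OF s] p_pos[OF s(1)] p1_pos by (intro mult_left_mono power_mono) auto
  ultimately have "(p s - p1) * p1 ^ (m - 1) \<le> A * (t1 - T) + M0 * exp (- s)"
    by (simp add: mm algebra_simps)
  then have "p s - p1 \<le> (A * (t1 - T) + M0 * exp (- s)) / p1 ^ (m - 1)"
    using p1_pos by (simp add: pos_le_divide_eq)
  then show ?thesis by simp
qed

lemma exp_T_le: "exp (- T) \<le> exp (- Tl)" using Tl_le by simp

lemma p_T_bounds: "p1 \<le> p T" "p T \<le> p1 + (A * (y1 / p1) + M0 * exp (- Tl)) / p1 ^ (m - 1)"
proof -
  show "p1 \<le> p T" using p_antimono[of T t1] t1 by simp
  have "A * (t1 - T) + M0 * exp (- T) \<le> A * (y1 / p1) + M0 * exp (- Tl)"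
    using A_nonneg M0_nonneg by (intro add_mono mult_left_mono L_le exp_T_le)
  then have "(A * (t1 - T) + M0 * exp (- T)) / p1 ^ (m - 1)
      \<le> (A * (y1 / p1) + M0 * exp (- Tl)) / p1 ^ (m - 1)"
    using p1_pos by (intro divide_right_mono) auto
  then show "p T \<le> p1 + (A * (y1 / p1) + M0 * exp (- Tl)) / p1 ^ (m - 1)"
    using p_outer[of T] t1 by simp
qed

text \<open>A second integration: \<open>p_outer\<close> has the form
  \<open>p s \<le> a + c * exp (- s)\<close>, hence \<open>y1 \<le> a * L + c * exp (- T)\<close>
  with \<open>L = t1 - T\<close>. Dividing by \<open>p1\<close> compares \<open>L\<close> with
  \<open>y1 / p1 = t1 - Tl\<close>.\<close>

lemma T_le: "T \<le> Tl + (A * (y1 / p1)\<^sup>2 + M0 * exp (- Tl)) / p1 ^ m"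
proof -
  have mm: "p1 ^ m = p1 * p1 ^ (m - 1)" using m_pos by (cases m) auto
  define L where "L = t1 - T"
  define c where "c = M0 / p1 ^ (m - 1)"
  define a where "a = p1 + A * L / p1 ^ (m - 1)"
  have "y1 - a * t1 + c * exp (- t1) \<le> y T - a * T + c * exp (- T)"
  proof (rule DERIV_nonpos_imp_decreasing_open[of T t1 "\<lambda>s. y s - a * s + c * exp (- s)"])
    show "\<exists>D. ((\<lambda>s. y s - a * s + c * exp (- s)) has_real_derivative D) (at x) \<and> D \<le> 0"
      if x: "T < x" "x < t1" for x
    proof (intro exI conjI)
      show "((\<lambda>s. y s - a * s + c * exp (- s)) has_real_derivative
          p x - a * 1 + c * (exp (- x) * - 1)) (at x)"
        using x by (intro DERIV_diff DERIV_add DERIV_cmult DERIV_ident y_deriv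
            DERIV_fun_exp derivative_intros) auto
      have "p x \<le> a + c * exp (- x)"
        using p_outer[of x] x by (simp add: a_def c_def L_def add_divide_distrib)
      then show "p x - a * 1 + c * (exp (- x) * - 1) \<le> 0" by simp
    qed
    show "continuous_on {T..t1} (\<lambda>s. y s - a * s + c * exp (- s))"
      by (intro continuous_intros continuous_on_subset[OF cont_y]) auto
  qed (use t1 in simp)
  moreover have "c * exp (- t1) \<ge> 0" using M0_nonneg p1_pos by (simp add: c_def)
  ultimately have "y1 \<le> a * L + c * exp (- T)"
    using y_T by (simp add: L_def algebra_simps)
  then have "y1 / p1 \<le> (a * L + c * exp (- T)) / p1"
    using p1_pos by (intro divide_right_mono) auto
  also have "\<dots> = L + (A * L\<^sup>2 + M0 * exp (- T)) / p1 ^ m"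
    using p1_pos by (simp add: a_def c_def mm field_simps power2_eq_square)
  also have "\<dots> \<le> L + (A * (y1 / p1)\<^sup>2 + M0 * exp (- Tl)) / p1 ^ m"
    using A_nonneg M0_nonneg p1_pos L_le t1
    by (intro add_left_mono divide_right_mono add_mono mult_left_mono exp_T_le power_mono)
      (auto simp: L_def)
  finally show ?thesis by (simp add: L_def Tl_def)
qed

end

section \<open>Expansions at the zero\<close>

lemma harm_le: "harm n \<le> (real n)"
proof -
  have "harm n \<le> (\<Sum>k=1..n. 1::real)"
    unfolding harm_def by (intro sum_mono) (auto simp: field_simps)
  then show ?thesis by simp
qed

lemma one_minus_power_le: "1 - (1 - r) ^ k \<le> k * r" if "r \<le> 1" for r :: real
  using Bernoulli_inequality[of "- r" k] that by simp

text \<open>\<open>J\<close> differs from \<open>z - harm\<close> by the sum of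
  \<open>(1 - (1 - r) ^ k) / k\<close> with \<open>r = exp (- z)\<close>, and Bernoulli bounds each
  summand by \<open>r\<close>. Dividing by \<open>(1 - r) ^ m\<close>, which is at least
  \<open>1 / 2\<close>, adds a relative error of order \<open>r\<close>.\<close>

lemma J_div_approx:
  fixes z j :: real
  assumes "z \<ge> 0" "2 * real (Suc m) * exp (- z) \<le> 1"
    and j_def: "j = J (Suc m) z / (1 - exp (- z)) ^ m"
  shows "\<bar>j - (z - harm (Suc m))\<bar> \<le> 2 * Suc m * (1 + z + Suc m) * exp (- z)"
    and "\<bar>j\<bar> \<le> 2 * z + 2 * Suc m + 1"
proof -
  define n where "n = Suc m"
  define r where "r = exp (- z)"
  define H :: real where "H = harm n"
  have r: "0 < r" "r \<le> 1" "2 * n * r \<le> 1" using assms by (auto simp: r_def n_def)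
  have H: "0 \<le> H" "H \<le> n" unfolding H_def by (simp_all add: harm_le harm_nonneg)
  have "J n z - (z - H) = (\<Sum>k=1..n. (1 - (1 - r) ^ k) / k)"
    by (simp add: J_def H_def harm_def r_def sum_subtractf diff_divide_distrib inverse_eq_divide)
  moreover have "\<dots> \<ge> 0"
    using r by (intro sum_nonneg divide_nonneg_nonneg) (auto intro: power_le_one)
  moreover have "\<dots> \<le> (\<Sum>k=1..n. r)"
    using one_minus_power_le[OF r(2)] by (intro sum_mono) (simp add: divide_le_eq mult.commute)
  ultimately have J: "0 \<le> J n z - (z - H)" "J n z - (z - H) \<le> n * r" by auto
  define v where "v = (1 - r) ^ m"
  have v: "1 - v \<le> m * r" "v \<le> 1"
    using one_minus_power_le[OF r(2)] r by (auto simp: v_def intro: power_le_one)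
  have "m * r \<le> n * r" using r by (simp add: n_def)
  then have v2: "v \<ge> 1 / 2" "1 - v \<le> n * r" using v r by linarith+
  have j: "j = J n z / v" by (simp add: j_def v_def r_def n_def)
  have "\<bar>(z - H) * (1 - v)\<bar> \<le> (z + n) * (n * r)"
    unfolding abs_mult using H v v2 assms(1) by (intro mult_mono) auto
  then have "\<bar>J n z - (z - H) * v\<bar> \<le> n * r + (z + n) * (n * r)"
    using J by (simp add: algebra_simps abs_le_iff)
  also have "\<dots> = n * (1 + z + n) * r" by (simp add: algebra_simps)
  finally have *: "\<bar>J n z - (z - H) * v\<bar> \<le> n * (1 + z + n) * r" .
  have "\<bar>j - (z - H)\<bar> = \<bar>J n z - (z - H) * v\<bar> / v"
  proof -
    have "j - (z - H) = (J n z - (z - H) * v) / v"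
      using v2 unfolding j by (simp add: diff_divide_distrib)
    then show ?thesis using v2 by simp
  qed
  also have "\<dots> \<le> \<bar>J n z - (z - H) * v\<bar> / (1 / 2)"
    using v2 by (intro divide_left_mono) auto
  also have "\<dots> \<le> 2 * (n * (1 + z + n) * r)" using * by simp
  finally have j1: "\<bar>j - (z - H)\<bar> \<le> 2 * n * (1 + z + n) * r" by (simp add: mult.assoc)
  then show "\<bar>j - (z - harm (Suc m))\<bar> \<le> 2 * Suc m * (1 + z + Suc m) * exp (- z)"
    unfolding H_def n_def r_def .
  have "2 * n * (1 + z + n) * r = (2 * n * r) * (1 + z + n)" by simp
  also have "\<dots> \<le> 1 * (1 + z + n)" using r assms(1) by (intro mult_right_mono) auto
  finally have "\<bar>j - (z - H)\<bar> \<le> 1 * (1 + z + n)" by (rule order_trans[OF j1])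
  then have "\<bar>j\<bar> \<le> \<bar>z - H\<bar> + (1 + z + n)"
    using abs_triangle_ineq[of "j - (z - H)" "z - H"] by simp
  then show "\<bar>j\<bar> \<le> 2 * z + 2 * Suc m + 1"
    using H assms(1) by (simp add: n_def abs_if split: if_splits)
qed

lemma exp_le_one_plus_double: "exp y \<le> 1 + 2 * y" if "0 \<le> y" "y \<le> 1" for y :: real
proof -
  have "exp y \<le> 1 + y + y\<^sup>2" using exp_bound[OF that] .
  also have "y\<^sup>2 \<le> y" using that by (simp add: power2_eq_square mult_left_le)
  finally show ?thesis by simp
qed

text \<open>Turns two-sided multiplicative bounds into an additive error. In use, \<open>x\<close>
  is the variation of \<open>g''\<close> and \<open>y\<close> a multiple of
  \<open>\<kappa>\<close>.\<close>

lemma squeeze_relative: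
  fixes v b j x y :: real
  assumes "0 \<le> b" "0 \<le> j" "0 \<le> x" "x \<le> 1" "0 \<le> y" "y \<le> 1"
    and "v \<le> b * (1 + x) * exp y * j" "b * (1 - x) * exp (- y) * j \<le> v"
  shows "\<bar>v - b * j\<bar> \<le> b * j * (x + 4 * y)"
proof -
  have bj: "0 \<le> b * j" using assms by simp
  have "x * y \<le> y" using assms by (simp add: mult_left_le_one_le)
  have "(1 + x) * exp y \<le> (1 + x) * (1 + 2 * y)"
    using assms by (intro mult_left_mono exp_le_one_plus_double) auto
  also have "\<dots> \<le> 1 + (x + 4 * y)" using \<open>x * y \<le> y\<close> by (simp add: algebra_simps)
  finally have "b * j * ((1 + x) * exp y) \<le> b * j * (1 + (x + 4 * y))"
    using bj by (rule mult_left_mono)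
  then have 1: "v \<le> b * j * (1 + (x + 4 * y))" using assms(7) by (simp add: mult_ac)
  have "(1 - x) * (1 - y) \<le> (1 - x) * exp (- y)"
    using assms exp_ge_add_one_self[of "- y"] by (intro mult_left_mono) auto
  moreover have "1 - (x + 4 * y) \<le> (1 - x) * (1 - y)" using assms by (simp add: algebra_simps)
  ultimately have "b * j * (1 - (x + 4 * y)) \<le> b * j * ((1 - x) * exp (- y))"
    using bj by (intro mult_left_mono) auto
  then have 2: "b * j * (1 - (x + 4 * y)) \<le> v" using assms(8) by (simp add: mult_ac)
  show ?thesis using 1 2 by (simp add: algebra_simps abs_le_iff)
qed

lemma zero_le_mult_imp: "0 < c \<Longrightarrow> 0 \<le> c * j \<Longrightarrow> 0 \<le> j" for c j :: real
  by (simp add: zero_le_mult_iff)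

lemma abs_le_of_mult_le: "\<bar>d\<bar> \<le> k * e" if "\<bar>d * a\<bar> \<le> k / 2 * e" "a \<ge> 1 / 2" for d a k e :: real
proof -
  have "\<bar>d\<bar> * (1 / 2) \<le> \<bar>d\<bar> * a" using that by (intro mult_left_mono) auto
  also have "\<dots> = \<bar>d * a\<bar>" using that by (simp add: abs_mult)
  finally show ?thesis using that by simp
qed

lemma abs_sum3_le:
  "s = u + v + w \<Longrightarrow> \<bar>u\<bar> \<le> U \<Longrightarrow> \<bar>v\<bar> \<le> V \<Longrightarrow> \<bar>w\<bar> \<le> W \<Longrightarrow> \<bar>s\<bar> \<le> U + V + W"
  for s u v w U V W :: real
  by linarith

lemma abs_sum4_le:
  "s = - u - v - w + t \<Longrightarrow> \<bar>u\<bar> \<le> U \<Longrightarrow> \<bar>v\<bar> \<le> V \<Longrightarrow> \<bar>w\<bar> \<le> W \<Longrightarrow> \<bar>t\<bar> \<le> Z \<Longrightarrow> \<bar>s\<bar> \<le> U + V + W + Z"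
  for s u v w t U V W Z :: real
  by linarith

text \<open>
  Here \<open>t1\<close> is the matching time, at which \<open>G (\<gamma> - y) / n = L \<delta>\<close>. Relative errors are measured by
  \<open>\<epsilon> = g''/G\<^sup>2\<close> and \<open>\<eta> = \<delta>\<^sup>2/G\<close>, and \<open>x\<close> bounds the relative variation of \<open>g''\<close> on \<open>[y t1, \<gamma>]\<close>. The constants
  \<open>L, M2, c2, Cx, u0, M0\<close> do not depend on \<open>\<gamma>\<close>, hence neither do those defined from them below.
\<close>

locale shooting_asymp = shooting m f g g1 g2 \<gamma> y p T
    + shooting_inner m f g g1 g2 \<gamma> y p T t1 lo N + shooting_outer m f g g1 g2 \<gamma> y p T t1 u0 M0
  for m f g g1 g2 \<gamma> y p T t1 lo N u0 M0 +
  fixes L M2 c2 Cx \<delta> X \<epsilon> \<eta> x :: real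
  assumes \<delta>_def: "\<delta> = ln (g1 \<gamma>)" and X_def: "X = \<gamma> * g1 \<gamma>"
    and \<epsilon>_def: "\<epsilon> = g2 \<gamma> / (g1 \<gamma>)\<^sup>2" and \<eta>_def: "\<eta> = \<delta>\<^sup>2 / g1 \<gamma>"
    and x_def: "x = Cx * \<delta> / X"
    and lo_def: "lo = g2 \<gamma> * (1 - x)" and N_def: "N = g2 \<gamma> * (1 + x)"
    and y1: "y t1 = \<gamma> - n * (L * \<delta>) / g1 \<gamma>"
    and L: "L \<ge> 1" and Cx: "Cx \<ge> 0"
    and \<delta>: "1 \<le> \<delta>" "\<delta> \<le> \<gamma>" "\<delta>\<^sup>2 \<le> 4 * g1 \<gamma>"
    and c2: "c2 > 0" "c2 \<le> \<gamma> * g2 \<gamma> / g1 \<gamma>" and M2: "\<gamma> * g2 \<gamma> / g1 \<gamma> \<le> M2"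
    and exp_L: "exp (- (L * \<delta>)) \<le> 1 / X ^ 4" "4 * real n * exp (- (L * \<delta>)) \<le> 1"
    and x_le: "x \<le> 1 / 2" and \<kappa>_le: "8 * real n * \<kappa> \<le> 1"
    and L_small: "4 * n * L * M2 * \<delta> \<le> X"
    and exp_u0: "X\<^sup>2 * exp (- (u0 * g1 \<gamma> / 4)) \<le> 1"
begin

section \<open>Size relations between \<open>X\<close>, \<open>\<epsilon>\<close>,
  \<open>\<eta>\<close>, \<open>x\<close> and \<open>\<kappa>\<close>\<close>

lemma G_ge: "G \<ge> 1" using \<delta> ln_le_minus_one[OF G_pos] \<delta>_def by linarith
lemma \<gamma>_ge: "\<gamma> \<ge> 1" using \<delta> by linarith
lemma X_ge: "X \<ge> G" "X \<ge> 1"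
proof -
  show "X \<ge> G" unfolding X_def using \<gamma>_ge G_pos by simp
  then show "X \<ge> 1" using G_ge by simp
qed
lemma z_t1: "z t1 = L * \<delta>" unfolding y1 using G_pos by (simp del: of_nat_Suc)
lemma X_times_\<epsilon>: "X * \<epsilon> = \<gamma> * g2 \<gamma> / G"
  using G_pos by (simp add: X_def \<epsilon>_def power2_eq_square)
lemma \<epsilon>_le: "\<epsilon> \<le> M2 / X" "c2 / X \<le> \<epsilon>" "0 \<le> \<epsilon>" "\<epsilon> \<le> M2" "0 < \<epsilon>" "M2 > 0"
proof -
  have *: "\<epsilon> = (\<gamma> * g2 \<gamma> / G) / X" unfolding X_times_\<epsilon>[symmetric] using X_ge by simp
  show "\<epsilon> \<le> M2 / X" "c2 / X \<le> \<epsilon>" unfolding * using c2 M2 X_ge by (intro divide_right_mono; simp)+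
  then show "0 < \<epsilon>" using c2 X_ge by (intro less_le_trans[of 0 "c2 / X" \<epsilon>] divide_pos_pos) auto
  then show "0 \<le> \<epsilon>" by simp
  show "M2 > 0" using c2 M2 by linarith
  then have "M2 / X \<le> M2 / 1" using X_ge by (intro divide_left_mono) auto
  then show "\<epsilon> \<le> M2" using \<open>\<epsilon> \<le> M2 / X\<close> by simp
qed
lemma x_nonneg: "x \<ge> 0" 
  unfolding x_def using Cx \<delta>(1) X_ge(2) by (intro divide_nonneg_nonneg mult_nonneg_nonneg) linarith+

lemma \<delta>_squared_ge: "\<delta> \<le> \<delta>\<^sup>2" "1 \<le> \<delta>\<^sup>2" 
  using self_le_power[of \<delta> 2] one_le_power[of \<delta> 2] \<delta>(1) by simp_all

lemma \<eta>_bounds: "\<delta>\<^sup>2 / X \<le> \<eta>" "\<delta> / X \<le> \<eta>" "1 / X \<le> \<eta>" "\<eta> \<ge> 0" "\<eta> \<le> 4" "\<delta> ^ 3 / X \<le> \<eta>"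
proof -
  show 1: "\<delta>\<^sup>2 / X \<le> \<eta>" unfolding \<eta>_def using X_ge G_pos by (intro divide_left_mono) auto
  have "\<delta> / X \<le> \<delta>\<^sup>2 / X" "1 / X \<le> \<delta>\<^sup>2 / X"
    using \<delta>_squared_ge X_ge by (intro divide_right_mono; simp)+
  then show "\<delta> / X \<le> \<eta>" "1 / X \<le> \<eta>" using 1 by linarith+
  show "\<eta> \<ge> 0" "\<eta> \<le> 4" unfolding \<eta>_def using G_pos \<delta> by (simp_all add: divide_le_eq)
  have "\<delta> ^ 3 / X = (\<delta> / \<gamma>) * \<eta>" by (simp add: X_def \<eta>_def power3_eq_cube power2_eq_square)
  also have "\<dots> \<le> 1 * \<eta>" using \<delta> \<gamma>_ge \<open>\<eta> \<ge> 0\<close> by (intro mult_right_mono) auto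
  finally show "\<delta> ^ 3 / X \<le> \<eta>" by simp
qed

lemma g2_pos: "g2 \<gamma> > 0" 
proof -
  have "\<epsilon> * G\<^sup>2 > 0" using \<epsilon>_le(5) G_pos by (intro mult_pos_pos) simp_all
  then show ?thesis using G_pos by (simp add: \<epsilon>_def)
qed

definition C\<kappa> where "C\<kappa> = 2 * real n ^ 2 * L\<^sup>2"

lemma \<kappa>_bound: "\<kappa> \<le> C\<kappa> * \<epsilon> * \<delta>\<^sup>2"
proof -
  have "\<kappa> = N * (n * (L * \<delta>) / G)\<^sup>2" unfolding \<kappa>_def y1 by simp
  also have "\<dots> = (1 + x) * (g2 \<gamma> * (n * (L * \<delta>) / G)\<^sup>2)" unfolding N_def by simp
  also have "\<dots> \<le> 2 * (g2 \<gamma> * (n * (L * \<delta>) / G)\<^sup>2)"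
    using x_le g2_pos by (intro mult_right_mono) auto
  also have "\<dots> = C\<kappa> * \<epsilon> * \<delta>\<^sup>2" by (simp add: C\<kappa>_def \<epsilon>_def power_mult_distrib power_divide)
  finally show ?thesis .
qed

text \<open>The extra factor \<open>\<delta>\<close> is free: \<open>\<epsilon> \<le> M2 / X\<close>
  reduces the claim to \<open>\<delta> ^ 3 / X = (\<delta> / \<gamma>) * \<eta>\<close>, and
  \<open>\<delta> \<le> \<gamma>\<close>.\<close>

lemma \<kappa>_le_\<eta>: "\<kappa> \<le> C\<kappa> * M2 * \<eta>" "\<delta> * \<kappa> \<le> C\<kappa> * M2 * \<eta>"
proof -
  have C: "C\<kappa> \<ge> 0" by (simp add: C\<kappa>_def)
  have "\<epsilon> * \<delta>\<^sup>2 * \<delta> \<le> M2 / X * \<delta>\<^sup>2 * \<delta>"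
    using \<epsilon>_le \<delta> by (intro mult_right_mono) auto
  also have "\<dots> = M2 * (\<delta> ^ 3 / X)" by (simp add: power2_eq_square power3_eq_cube)
  also have "\<dots> \<le> M2 * \<eta>" using \<eta>_bounds \<epsilon>_le by (intro mult_left_mono) auto
  finally have "C\<kappa> * (\<epsilon> * \<delta>\<^sup>2 * \<delta>) \<le> C\<kappa> * (M2 * \<eta>)" using C by (intro mult_left_mono)
  moreover have "\<kappa> * \<delta> \<le> C\<kappa> * \<epsilon> * \<delta>\<^sup>2 * \<delta>" using \<kappa>_bound \<delta> by (intro mult_right_mono) auto
  ultimately show 1: "\<delta> * \<kappa> \<le> C\<kappa> * M2 * \<eta>" by (simp add: mult_ac)
  have "1 * \<kappa> \<le> \<delta> * \<kappa>" using \<delta> \<kappa>_nonneg by (intro mult_right_mono) auto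
  then show "\<kappa> \<le> C\<kappa> * M2 * \<eta>" using 1 by simp
qed

lemma exp_L_X: "exp (- (L * \<delta>)) \<le> 1 / X" "exp (- (L * \<delta>)) \<le> 1 / X\<^sup>2"
proof -
  have "1 / X ^ 4 \<le> 1 / X ^ 1" "1 / X ^ 4 \<le> 1 / X ^ 2" using X_ge
    by (intro divide_left_mono power_increasing; simp)+
  then show "exp (- (L * \<delta>)) \<le> 1 / X" "exp (- (L * \<delta>)) \<le> 1 / X\<^sup>2"
    using exp_L by (simp_all del: power_one_right add: power_one_right)
qed

lemma \<delta>x_le_\<eta>: "\<delta> * x \<le> Cx * \<eta>"
proof -
  have "\<delta> * x = Cx * (\<delta>\<^sup>2 / X)" by (simp add: x_def power2_eq_square)
  also have "\<dots> \<le> Cx * \<eta>" using Cx \<eta>_bounds by (intro mult_left_mono) auto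
  finally show ?thesis .
qed

section \<open>Slope at the matching time to second order\<close>

definition CR where
  "CR = real n * ((2 * L + 2 * n + 1) * (Cx + 16 * n * C\<kappa> * M2) + 2 * n * (1 + L + n))"

text \<open>The quotient \<open>j\<close> grows like \<open>\<delta>\<close>, so the relative errors
  \<open>x\<close> and \<open>\<kappa>\<close> are each multiplied by \<open>\<delta>\<close>; both
  \<open>\<delta> * x\<close> and \<open>\<delta> * \<kappa>\<close> are still of order
  \<open>\<eta>\<close>. Replacing \<open>j\<close> by \<open>L * \<delta> - harm n\<close> costs
  about \<open>\<delta> * exp (- (L * \<delta>))\<close>, also of order
  \<open>\<eta>\<close>.\<close>

lemma R_quotient_approx: "\<bar>R t1 / p1 ^ m - n * \<epsilon> * (L * \<delta> - harm n)\<bar> \<le> CR * \<epsilon> * \<eta>"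
proof -
  define j where "j = J n (L * \<delta>) / (1 - exp (- (L * \<delta>))) ^ m"
  define v where "v = R t1 / p1 ^ m"
  define s where "s = 2 * (real n + real m) * \<kappa>"
  have s: "0 \<le> s" "s \<le> 4 * real n * \<kappa>" "s \<le> 1"
  proof -
    show "0 \<le> s" unfolding s_def using \<kappa>_nonneg by (intro mult_nonneg_nonneg) auto
    have "2 * (real n + real m) \<le> 4 * real n" by simp
    from mult_right_mono[OF this \<kappa>_nonneg] show s4: "s \<le> 4 * real n * \<kappa>" unfolding s_def .
    have "4 * real n * \<kappa> = (8 * real n * \<kappa>) / 2" by (simp del: of_nat_Suc)
    also have "\<dots> \<le> 1 / 2" using \<kappa>_le by (rule divide_right_mono) simp
    finally have "4 * real n * \<kappa> \<le> 1 / 2" .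
    from order_trans[OF s4 this] show "s \<le> 1" by simp
  qed
  have v1: "v \<le> (n * \<epsilon>) * (1 + x) * exp s * j" "(n * \<epsilon>) * (1 - x) * exp (- s) * j \<le> v"
  proof -
    have NG: "N * (n / G\<^sup>2) = (n * \<epsilon>) * (1 + x)" "lo * (n / G\<^sup>2) = (n * \<epsilon>) * (1 - x)"
      unfolding N_def lo_def \<epsilon>_def by (simp_all add: mult_ac del: of_nat_Suc)
    have s': "- 2 * (real n + real m) * \<kappa> = - s" by (simp only: s_def mult_minus_left)
    note RB = R_div_bounds[of t1, unfolded z_t1 NG s', folded j_def v_def s_def]
    show "v \<le> (n * \<epsilon>) * (1 + x) * exp s * j" "(n * \<epsilon>) * (1 - x) * exp (- s) * j \<le> v"
      using RB(1)[OF order_refl] RB(2)[OF order_refl] .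
  qed
  have "v \<ge> 0" using R_nonneg[of t1] p1_pos by (simp add: v_def)
  then have "0 \<le> ((n * \<epsilon>) * (1 + x) * exp s) * j" using v1 by linarith
  moreover have "(n * \<epsilon>) * (1 + x) * exp s > 0"
    using \<epsilon>_le(5) x_nonneg by (intro mult_pos_pos) simp_all
  ultimately have j0: "j \<ge> 0" by (rule zero_le_mult_imp[rotated])
  have L\<delta>: "L * \<delta> \<ge> 0" using L \<delta> by simp
  have r2: "2 * real (Suc m) * exp (- (L * \<delta>)) \<le> 1"
  proof -
    have "2 * real n * exp (- (L * \<delta>)) \<le> 4 * real n * exp (- (L * \<delta>))"
      by (intro mult_right_mono) auto
    then show ?thesis using exp_L(2) by (rule order_trans)
  qed
  note jj = J_div_approx[OF L\<delta> r2 j_def]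
  have 1: "\<bar>v - (n * \<epsilon>) * j\<bar> \<le> (n * \<epsilon>) * j * (x + 4 * s)"
  proof (rule squeeze_relative[OF _ j0 x_nonneg _ s(1,3) v1])
    show "x \<le> 1" using x_le by linarith
    show "0 \<le> n * \<epsilon>" using \<epsilon>_le(3) by (intro mult_nonneg_nonneg) auto
  qed
  have "j * (x + 4 * s) \<le> ((2 * L + 2 * n + 1) * \<delta>) * (x + 4 * s)"
  proof (rule mult_right_mono)
    have "j \<le> 2 * (L * \<delta>) + (2 * real n + 1) * 1" using jj(2) by simp
    also have "\<dots> \<le> 2 * (L * \<delta>) + (2 * real n + 1) * \<delta>"
      using \<delta> by (intro add_left_mono mult_left_mono) auto
    also have "\<dots> = (2 * L + 2 * n + 1) * \<delta>" by (simp add: distrib_right)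
    finally show "j \<le> (2 * L + 2 * n + 1) * \<delta>" .
  qed (use x_nonneg s in auto)
  also have "\<dots> = (2 * L + 2 * n + 1) * (\<delta> * x + 4 * (\<delta> * s))" by (simp add: algebra_simps del: of_nat_Suc)
  also have "\<dots> \<le> (2 * L + 2 * n + 1) * (Cx * \<eta> + 4 * (4 * n * C\<kappa> * M2 * \<eta>))"
  proof (intro mult_left_mono add_mono)
    show "\<delta> * x \<le> Cx * \<eta>" by (rule \<delta>x_le_\<eta>)
    have "\<delta> * s \<le> \<delta> * (4 * real n * \<kappa>)" using s \<delta> by (intro mult_left_mono) auto
    also have "\<dots> = 4 * real n * (\<delta> * \<kappa>)" by simp
    also have "\<dots> \<le> 4 * real n * (C\<kappa> * M2 * \<eta>)" by (intro mult_left_mono \<kappa>_le_\<eta>) auto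
    finally show "\<delta> * s \<le> 4 * n * C\<kappa> * M2 * \<eta>" by (simp add: mult.assoc)
  qed (use L in auto)
  finally have 2: "j * (x + 4 * s) \<le> (2 * L + 2 * n + 1) * (Cx + 16 * n * C\<kappa> * M2) * \<eta>"
    by (simp add: algebra_simps del: of_nat_Suc)
  have "L * \<delta> + (1 + real n) * 1 \<le> L * \<delta> + (1 + real n) * \<delta>"
    using \<delta> by (intro add_left_mono mult_left_mono) auto
  then have "1 + L * \<delta> + n \<le> (1 + L + n) * \<delta>" by (simp add: distrib_right)
  then have "(1 + L * \<delta> + n) * exp (- (L * \<delta>)) \<le> ((1 + L + n) * \<delta>) * (1 / X)"
    using exp_L_X L \<delta> by (intro mult_mono) auto
  also have "\<dots> = (1 + L + n) * (\<delta> / X)" by simp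
  also have "\<dots> \<le> (1 + L + n) * \<eta>" using L \<eta>_bounds by (intro mult_left_mono) auto
  finally have "2 * n * ((1 + L * \<delta> + n) * exp (- (L * \<delta>))) \<le> 2 * n * ((1 + L + n) * \<eta>)"
    by (intro mult_left_mono) auto
  then have 3: "\<bar>j - (L * \<delta> - harm n)\<bar> \<le> 2 * n * (1 + L + n) * \<eta>"
    using jj(1) unfolding mult.assoc by (rule order_trans[rotated])
  have "\<bar>v - n * \<epsilon> * (L * \<delta> - harm n)\<bar>
      \<le> \<bar>v - (n * \<epsilon>) * j\<bar> + \<bar>(n * \<epsilon>) * (j - (L * \<delta> - harm n))\<bar>"
    using abs_triangle_ineq[of "v - (n * \<epsilon>) * j" "(n * \<epsilon>) * (j - (L * \<delta> - harm n))"]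
    by (simp add: right_diff_distrib del: of_nat_Suc)
  also have "\<bar>(n * \<epsilon>) * (j - (L * \<delta> - harm n))\<bar> = (n * \<epsilon>) * \<bar>j - (L * \<delta> - harm n)\<bar>"
    using \<epsilon>_le by (simp add: abs_mult del: of_nat_Suc)
  also have "\<bar>v - (n * \<epsilon>) * j\<bar> + \<dots> \<le> (n * \<epsilon>) * ((2 * L + 2 * n + 1) * (Cx + 16 * n * C\<kappa> * M2) * \<eta>)
      + (n * \<epsilon>) * (2 * n * (1 + L + n) * \<eta>)"
  proof (rule add_mono)
    have n\<epsilon>: "0 \<le> n * \<epsilon>" using \<epsilon>_le by simp
    from 1 mult_left_mono[OF 2 n\<epsilon>]
    show "\<bar>v - (n * \<epsilon>) * j\<bar> \<le> (n * \<epsilon>) * ((2 * L + 2 * n + 1) * (Cx + 16 * n * C\<kappa> * M2) * \<eta>)"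
      unfolding mult.assoc[of "n * \<epsilon>" j] by (rule order_trans)
    from 3 n\<epsilon> show "(n * \<epsilon>) * \<bar>j - (L * \<delta> - harm n)\<bar> \<le> (n * \<epsilon>) * (2 * n * (1 + L + n) * \<eta>)"
      by (rule mult_left_mono)
  qed
  also have "\<dots> = CR * \<epsilon> * \<eta>" by (simp add: CR_def algebra_simps del: of_nat_Suc)
  finally show ?thesis unfolding v_def .
qed

definition P where "P = p1 / P0"
abbreviation H :: real where "H \<equiv> harm n"

lemma H_bounds: "0 \<le> H" "H \<le> n" by (simp_all add: harm_nonneg harm_le del: of_nat_Suc)

lemma p1_eq: "p1 = P0 * P" using P0_pos by (simp add: P_def)

lemma \<kappa>_small: "\<kappa> \<le> 1 / 16"
proof -
  have "16 * \<kappa> \<le> 8 * real n * \<kappa>" using m_pos \<kappa>_nonneg by (intro mult_right_mono) auto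
  then show ?thesis using \<kappa>_le by linarith
qed

lemma exp_L_small: "exp (- (L * \<delta>)) \<le> 1 / 8"
proof -
  have "8 * exp (- (L * \<delta>)) \<le> 4 * real n * exp (- (L * \<delta>))" using m_pos by (intro mult_right_mono) auto
  then show ?thesis using exp_L by linarith
qed

lemma exp_2\<kappa>: "exp (2 * \<kappa>) \<le> 2"
  using exp_le_one_plus_double[of "2 * \<kappa>"] \<kappa>_small \<kappa>_nonneg by linarith

lemma P_bounds: "1 / 2 \<le> P" "P \<le> 2"
proof -
  have "p1 \<le> P0 * (1 - exp (- (L * \<delta>))) * exp (2 * \<kappa>)"
    "P0 * (1 - exp (- (L * \<delta>))) * exp (- 2 * \<kappa>) \<le> p1"
    using p_bounds[of t1] unfolding z_t1 by simp_all
  then have *: "P \<le> (1 - exp (- (L * \<delta>))) * exp (2 * \<kappa>)"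
    "(1 - exp (- (L * \<delta>))) * exp (- 2 * \<kappa>) \<le> P"
    using P0_pos unfolding p1_eq by (simp_all add: mult.assoc)
  have "L * \<delta> \<ge> 0" using L \<delta> by simp
  have "(1 - exp (- (L * \<delta>))) * exp (2 * \<kappa>) \<le> 1 * 2"
    using exp_L_small exp_2\<kappa> by (intro mult_mono) auto
  then show "P \<le> 2" using * by linarith
  have "(3 / 4) * (3 / 4) \<le> (1 - exp (- (L * \<delta>))) * exp (- 2 * \<kappa>)"
    using exp_L_small \<kappa>_small exp_ge_add_one_self[of "- 2 * \<kappa>"] \<open>L * \<delta> \<ge> 0\<close> by (intro mult_mono) auto
  then show "1 / 2 \<le> P" using * by linarith
qed

lemma P0_bounds: "1 / G \<le> P0" "P0 \<le> 2 / G"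
proof -
  have "1 \<le> real n / m" "real n / m \<le> 2" using m_pos by (auto simp: field_simps)
  then have "1 / G \<le> (real n / m) / G" "(real n / m) / G \<le> 2 / G"
    using G_pos by (intro divide_right_mono; simp)+
  moreover have "P0 = (real n / m) / G" by (simp add: P0_def)
  ultimately show "1 / G \<le> P0" "P0 \<le> 2 / G" by simp_all
qed

text \<open>Makes any error of order \<open>X^-2\<close> admissible in the slope. This is where the
  lower bound \<open>c2\<close> on \<open>\<gamma> g'' / g'\<close> enters.\<close>

lemma inverse_X2: "1 / X\<^sup>2 \<le> \<epsilon> * \<eta> / c2"
proof -
  have "1 / X\<^sup>2 = (1 / X) * (1 / X)" by (simp add: power2_eq_square)
  also have "\<dots> \<le> (\<epsilon> / c2) * \<eta>"
  proof (intro mult_mono)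
    have "(c2 / X) / c2 \<le> \<epsilon> / c2" using c2 \<epsilon>_le by (intro divide_right_mono) auto
    then show "1 / X \<le> \<epsilon> / c2" using c2 by simp
  qed (use X_ge \<eta>_bounds \<epsilon>_le c2 in auto)
  finally show ?thesis by simp
qed

lemma F_t1_le: "F t1 \<le> 2 * exp (- (L * \<delta>)) * p1 ^ m"
proof -
  have "F t1 \<le> p1 ^ m * exp (- (L * \<delta>) + 2 * \<kappa>)" using F_le[of t1] unfolding z_t1 by simp
  also have "exp (- (L * \<delta>) + 2 * \<kappa>) \<le> exp (- (L * \<delta>)) * 2"
    unfolding exp_add using exp_2\<kappa> by (intro mult_left_mono) auto
  finally show ?thesis using p1_pos by (simp add: mult_ac)
qed

text \<open>The drop of \<open>g1\<close> between \<open>\<gamma>\<close> and the matching point has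
  relative size \<open>\<epsilon> * \<delta>\<close>, larger than the correction sought, so it must
  be kept explicitly; it later cancels against the \<open>L * \<delta>\<close> part of
  \<open>R\<close>.\<close>

lemma a_approx: "\<bar>g1 y1 / G - (1 - n * \<epsilon> * L * \<delta>)\<bar> \<le> n * \<epsilon> * L * \<delta> * x" "g1 y1 / G \<ge> 1 / 2"
proof -
  have "y1 < \<gamma>" using y_t1 by simp
  moreover have "(g1 has_real_derivative g2 u) (at u)" if "y1 \<le> u" for u
    using that y_t1 by (intro g1_deriv) linarith
  ultimately obtain u where u: "y1 < u" "u < \<gamma>" "g1 \<gamma> - g1 y1 = (\<gamma> - y1) * g2 u"
    using MVT2[of y1 \<gamma> g1 g2] by blast
  have g2u: "g2 \<gamma> * (1 - x) \<le> g2 u" "g2 u \<le> g2 \<gamma> * (1 + x)"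
    using g2_bounds[of u] u unfolding lo_def N_def by auto
  define c where "c = n * L * \<delta> / G\<^sup>2"
  have c: "c \<ge> 0" using L \<delta> by (simp add: c_def)
  have "g1 y1 / G = 1 - (\<gamma> - y1) * g2 u / G" using u(3) G_pos by (simp add: field_simps)
  also have "(\<gamma> - y1) * g2 u / G = c * g2 u"
    unfolding y1 by (simp add: c_def power2_eq_square del: of_nat_Suc)
  finally have a: "g1 y1 / G = 1 - c * g2 u" .
  have ce: "c * g2 \<gamma> = n * \<epsilon> * L * \<delta>" by (simp add: c_def \<epsilon>_def del: of_nat_Suc)
  have "c * (g2 \<gamma> * (1 - x)) \<le> c * g2 u" "c * g2 u \<le> c * (g2 \<gamma> * (1 + x))"
    using g2u c by (intro mult_left_mono; simp)+
  then have *: "n * \<epsilon> * L * \<delta> * (1 - x) \<le> c * g2 u" "c * g2 u \<le> n * \<epsilon> * L * \<delta> * (1 + x)"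
    unfolding mult.assoc[symmetric] ce by auto
  then show "\<bar>g1 y1 / G - (1 - n * \<epsilon> * L * \<delta>)\<bar> \<le> n * \<epsilon> * L * \<delta> * x"
    unfolding a distrib_left right_diff_distrib by linarith
  have "n * \<epsilon> * L * \<delta> * (1 + x) \<le> n * \<epsilon> * L * \<delta> * 2"
    using x_le \<epsilon>_le L \<delta> by (intro mult_left_mono) auto
  also have "\<dots> = (2 * real n * L * \<delta>) * \<epsilon>" by simp
  also have "\<dots> \<le> (2 * real n * L * \<delta>) * (M2 / X)" using L \<delta> \<epsilon>_le by (intro mult_left_mono) auto
  also have "\<dots> = (4 * real n * L * M2 * \<delta>) / X / 2"
    by (simp add: mult_ac del: of_nat_Suc)
  also have "\<dots> \<le> 1 / 2"
  proof -
    have "4 * real n * L * M2 * \<delta> \<le> X" using L_small by simp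
    from divide_right_mono[OF this, of X] have "4 * real n * L * M2 * \<delta> / X \<le> 1" using X_ge by simp
    then show ?thesis by (rule divide_right_mono) simp
  qed
  finally show "g1 y1 / G \<ge> 1 / 2" using * a by linarith
qed

lemma \<epsilon>\<delta>_le_\<eta>: "\<epsilon> * \<delta> \<le> M2 * \<eta>" and \<epsilon>_le_\<eta>: "\<epsilon> \<le> M2 * \<eta>"
proof -
  have "\<epsilon> * \<delta> \<le> M2 / X * \<delta>" using \<epsilon>_le \<delta> by (intro mult_right_mono) auto
  also have "\<dots> = M2 * (\<delta> / X)" by simp
  also have "\<dots> \<le> M2 * \<eta>" using \<epsilon>_le \<eta>_bounds by (intro mult_left_mono) auto
  finally show "\<epsilon> * \<delta> \<le> M2 * \<eta>" .
  moreover have "\<epsilon> * 1 \<le> \<epsilon> * \<delta>" using \<epsilon>_le \<delta> by (intro mult_left_mono) auto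
  ultimately show "\<epsilon> \<le> M2 * \<eta>" by simp
qed

text \<open>The bracket lists the contributions of \<open>F\<close>, of \<open>R\<close>, of
  \<open>g1 y1\<close> and of the product of the two first-order terms; the outer \<open>2\<close>
  pays for dividing by \<open>g1 y1 / G \<ge> 1 / 2\<close>.\<close>

definition CP where
  "CP = 2 * (2 / c2 + CR + (1 + real n ^ 2 * M2) * (n * L * Cx) + real n ^ 3 * L * M2)"

lemma slope: "\<bar>P - 1 - n * \<epsilon> * H\<bar> \<le> CP * (\<epsilon> * \<eta>)"
proof -
  define a where "a = g1 y1 / G"
  define FQ where "FQ = F t1 / p1 ^ m"
  define RQ where "RQ = R t1 / p1 ^ m"
  have pm: "p1 ^ m > 0" using p1_pos by simp
  \<comment> \<open>Divided by \<open>p1 ^ m\<close>, the definition of \<open>R\<close> is linear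
    in \<open>p1\<close> apart from the quotients \<open>FQ\<close> and \<open>RQ\<close>, so it can
    be solved for the slope.\<close>
  have "RQ = 1 - m / n * g1 y1 * p1 - FQ"
    using pm p1_pos by (simp add: RQ_def FQ_def R_def diff_divide_distrib del: of_nat_Suc)
  moreover have "m / n * g1 y1 * p1 = P * a"
    using G_pos m_pos unfolding p1_eq by (simp add: P0_def a_def del: of_nat_Suc)
  ultimately have Pa: "P * a = 1 - FQ - RQ" by simp
  have FQ: "\<bar>FQ\<bar> \<le> 2 / c2 * (\<epsilon> * \<eta>)"
  proof -
    have "FQ \<le> 2 * exp (- (L * \<delta>))" using F_t1_le pm by (simp add: FQ_def divide_le_eq)
    also have "\<dots> \<le> 2 * (\<epsilon> * \<eta> / c2)" using exp_L_X inverse_X2 by (intro mult_left_mono) linarith+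
    finally show ?thesis using F_pos[OF t1] pm by (simp add: FQ_def)
  qed
  have RQ: "\<bar>RQ - n * \<epsilon> * (L * \<delta> - H)\<bar> \<le> CR * (\<epsilon> * \<eta>)"
    using R_quotient_approx by (simp add: RQ_def mult.assoc)
  have 3: "\<bar>(1 + n * \<epsilon> * H) * (a - (1 - n * \<epsilon> * L * \<delta>))\<bar>
      \<le> (1 + real n ^ 2 * M2) * (n * L * Cx) * (\<epsilon> * \<eta>)"
  proof -
    have "n * \<epsilon> * H \<le> n * M2 * n" using \<epsilon>_le H_bounds by (intro mult_mono) auto
    then have "\<bar>1 + n * \<epsilon> * H\<bar> \<le> 1 + real n ^ 2 * M2"
      using \<epsilon>_le H_bounds by (simp add: power2_eq_square mult_ac del: of_nat_Suc)
    moreover have "\<bar>a - (1 - n * \<epsilon> * L * \<delta>)\<bar> \<le> n * L * Cx * (\<epsilon> * \<eta>)"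
    proof -
      have "n * \<epsilon> * L * \<delta> * x = (n * L * \<epsilon>) * (\<delta> * x)" by simp
      also have "\<dots> \<le> (n * L * \<epsilon>) * (Cx * \<eta>)" using L \<epsilon>_le by (intro mult_left_mono \<delta>x_le_\<eta>) auto
      finally show ?thesis using a_approx by (simp add: a_def mult_ac del: of_nat_Suc)
    qed
    moreover have "0 \<le> 1 + real n ^ 2 * M2" using \<epsilon>_le by simp
    ultimately show ?thesis unfolding abs_mult mult.assoc[of "1 + real n ^ 2 * M2"]
      by (intro mult_mono) auto
  qed
  have 4: "\<bar>real n ^ 2 * \<epsilon> ^ 2 * H * L * \<delta>\<bar> \<le> real n ^ 3 * L * M2 * (\<epsilon> * \<eta>)"
  proof -
    have "real n ^ 2 * \<epsilon> ^ 2 * H * L * \<delta> = (real n ^ 2 * L * \<epsilon>) * (H * (\<epsilon> * \<delta>))"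
      by (simp add: power2_eq_square)
    also have "\<dots> \<le> (real n ^ 2 * L * \<epsilon>) * (n * (M2 * \<eta>))"
      using L \<epsilon>_le \<delta> by (intro mult_left_mono mult_mono[OF H_bounds(2) \<epsilon>\<delta>_le_\<eta>]) auto
    also have "\<dots> = real n ^ 3 * L * M2 * (\<epsilon> * \<eta>)" by (simp add: power2_eq_square power3_eq_cube)
    finally show ?thesis using L \<epsilon>_le H_bounds \<delta> by simp
  qed
  \<comment> \<open>The terms \<open>n * \<epsilon> * L * \<delta>\<close> of \<open>RQ\<close> and
    of \<open>a\<close> cancel here, leaving \<open>n * \<epsilon> * H\<close>: the slope does not
    see the matching depth to this order.\<close>
  have "(P - 1 - n * \<epsilon> * H) * a = - FQ - (RQ - n * \<epsilon> * (L * \<delta> - H))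
      - (1 + n * \<epsilon> * H) * (a - (1 - n * \<epsilon> * L * \<delta>)) + real n ^ 2 * \<epsilon> ^ 2 * H * L * \<delta>"
    using Pa by algebra
  have CP_half: "CP / 2 = 2 / c2 + CR + (1 + real n ^ 2 * M2) * (n * L * Cx) + real n ^ 3 * L * M2"
    unfolding CP_def by simp
  note abs_sum4_le[OF \<open>(P - 1 - n * \<epsilon> * H) * a = _\<close>]
  from this[OF FQ RQ 3 4] have "\<bar>(P - 1 - n * \<epsilon> * H) * a\<bar> \<le> CP / 2 * (\<epsilon> * \<eta>)"
    unfolding CP_half distrib_right[symmetric] .
  moreover have "a \<ge> 1 / 2" using a_approx(2) unfolding a_def .
  ultimately show ?thesis by (rule abs_le_of_mult_le)
qed

lemma CP_nonneg: "CP \<ge> 0"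
proof -
  have "C\<kappa> \<ge> 0" by (simp add: C\<kappa>_def)
  then have "CR \<ge> 0" using L Cx \<epsilon>_le unfolding CR_def
    by (intro mult_nonneg_nonneg add_nonneg_nonneg) auto
  then show ?thesis using c2 L Cx \<epsilon>_le unfolding CP_def
    by (intro mult_nonneg_nonneg add_nonneg_nonneg) auto
qed

section \<open>Zero of the tangent line\<close>

definition E where "E = g \<gamma> - m / n * X"
text \<open>The predicted zero: \<open>E - m * ln P0\<close> is where a line of slope
  \<open>P0\<close> would arrive, and the last term is the delay
  \<open>(m / n) * X * (n * \<epsilon> * H)\<close> caused by the steeper slope.\<close>

definition Tstar where "Tstar = E - m * ln P0 + H * m * (X * \<epsilon>)"
definition CQ where "CQ = 2 * (real n ^ 2 + 4 * CP)"
definition CT where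
  "CT = m * (C\<kappa> * M2 + 2) + m * L * CQ * M2 + M2 * (2 * CP + real n ^ 2 * CQ * M2)"

lemma y1_div_p1: "y1 / p1 = (m / n * X - m * L * \<delta>) / P"
proof -
  have "y1 / P0 = m / n * X - m * L * \<delta>"
    unfolding y1 using G_pos m_pos by (simp add: P0_def X_def field_simps del: of_nat_Suc)
  then show ?thesis unfolding p1_eq by (metis divide_divide_eq_left)
qed

lemma Tl_approx: "\<bar>Tl - Tstar\<bar> \<le> CT * \<eta>"
proof -
  define q where "q = 1 / P"
  have q: "q * P = 1" "0 \<le> q" "q \<le> 2" using P_bounds by (auto simp: q_def divide_le_eq)
  have nHe: "0 \<le> n * \<epsilon> * H" "n * \<epsilon> * H \<le> real n ^ 2 * \<epsilon>"
  proof -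
    have "n * \<epsilon> * H \<le> n * \<epsilon> * n" using \<epsilon>_le H_bounds by (intro mult_left_mono) auto
    then show "n * \<epsilon> * H \<le> real n ^ 2 * \<epsilon>" by (simp add: power2_eq_square mult_ac del: of_nat_Suc)
  qed (use \<epsilon>_le H_bounds in auto)
  have e\<eta>: "CP * (\<epsilon> * \<eta>) \<le> 4 * CP * \<epsilon>"
  proof -
    have "CP * (\<epsilon> * \<eta>) \<le> CP * (\<epsilon> * 4)"
      using CP_nonneg \<epsilon>_le \<eta>_bounds by (intro mult_left_mono) auto
    then show ?thesis by simp
  qed
  have "\<bar>P - 1\<bar> \<le> (real n ^ 2 + 4 * CP) * \<epsilon>"
    unfolding distrib_right using slope nHe e\<eta> by linarith
  then have "q * \<bar>P - 1\<bar> \<le> 2 * ((real n ^ 2 + 4 * CP) * \<epsilon>)" using q by (intro mult_mono) auto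
  moreover have "q * \<bar>P - 1\<bar> = \<bar>q - 1\<bar>"
  proof -
    have "q * \<bar>P - 1\<bar> = \<bar>q * (P - 1)\<bar>" using q by (simp add: abs_mult)
    also have "q * (P - 1) = - (q - 1)" using q by (simp add: right_diff_distrib)
    finally show ?thesis by simp
  qed
  ultimately have q1: "\<bar>q - 1\<bar> \<le> CQ * \<epsilon>" by (simp add: CQ_def mult_ac)
  have CQ: "CQ \<ge> 0" using CP_nonneg by (simp add: CQ_def)
  have 1: "\<bar>t1 - (g \<gamma> - m * ln P0 - m * L * \<delta>)\<bar> \<le> m * (C\<kappa> * M2 + 2) * \<eta>"
  proof -
    have "\<bar>t1 - (g \<gamma> - m * ln P0 - m * (L * \<delta>))\<bar> \<le> m * (\<kappa> + 2 * exp (- (L * \<delta>)))"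
      using t_approx[of t1] exp_L_small unfolding z_t1 by simp
    also have "\<dots> \<le> m * (C\<kappa> * M2 * \<eta> + 2 * \<eta>)"
      using \<kappa>_le_\<eta> exp_L_X \<eta>_bounds by (intro mult_left_mono add_mono) linarith+
    finally show ?thesis by (simp add: algebra_simps)
  qed
  have 2: "\<bar>m * L * \<delta> * (q - 1)\<bar> \<le> m * L * CQ * M2 * \<eta>"
  proof -
    have "\<bar>m * L * \<delta> * (q - 1)\<bar> = m * L * \<delta> * \<bar>q - 1\<bar>" using L \<delta> by (simp add: abs_mult)
    also have "\<dots> \<le> m * L * \<delta> * (CQ * \<epsilon>)" using L \<delta> by (intro mult_left_mono q1) auto
    also have "\<dots> = m * L * CQ * (\<epsilon> * \<delta>)" by simp
    also have "\<dots> \<le> m * L * CQ * (M2 * \<eta>)" using L CQ by (intro mult_left_mono \<epsilon>\<delta>_le_\<eta>) auto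
    finally show ?thesis by (simp add: mult.assoc)
  qed
  have "\<bar>1 - q - n * \<epsilon> * H\<bar> \<le> 2 * (CP * (\<epsilon> * \<eta>)) + (real n ^ 2 * \<epsilon>) * (CQ * \<epsilon>)"
  proof -
    have "1 - q - n * \<epsilon> * H = q * (P - 1 - n * \<epsilon> * H) + n * \<epsilon> * H * (q - 1)" using q(1) by algebra
    moreover have "\<bar>q * (P - 1 - n * \<epsilon> * H)\<bar> \<le> 2 * (CP * (\<epsilon> * \<eta>))"
      unfolding abs_mult using q slope by (intro mult_mono) auto
    moreover have "\<bar>n * \<epsilon> * H * (q - 1)\<bar> \<le> (real n ^ 2 * \<epsilon>) * (CQ * \<epsilon>)"
      unfolding abs_mult[of "n * \<epsilon> * H"] using q1 nHe by (intro mult_mono) auto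
    ultimately show ?thesis by linarith
  qed
  \<comment> \<open>The outer length multiplies the slope error by \<open>X\<close>; one factor
    \<open>\<epsilon>\<close> is absorbed by \<open>X * \<epsilon> \<le> M2\<close>, and what
    remains is of order \<open>\<eta>\<close>.\<close>
  then have "X * \<bar>1 - q - n * \<epsilon> * H\<bar> \<le> X * (2 * (CP * (\<epsilon> * \<eta>)) + (real n ^ 2 * \<epsilon>) * (CQ * \<epsilon>))"
    using X_ge by (intro mult_left_mono) auto
  also have "\<dots> = (X * \<epsilon>) * (2 * CP * \<eta> + real n ^ 2 * CQ * \<epsilon>)" by (simp add: algebra_simps)
  also have "\<dots> \<le> M2 * (2 * CP * \<eta> + real n ^ 2 * CQ * (M2 * \<eta>))"
    using M2 X_times_\<epsilon> \<epsilon>_le_\<eta> \<epsilon>_le CP_nonneg CQ \<eta>_bounds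
    by (intro mult_mono add_mono mult_left_mono add_nonneg_nonneg) auto
  finally have 3: "X * \<bar>1 - q - n * \<epsilon> * H\<bar> \<le> M2 * (2 * CP + real n ^ 2 * CQ * M2) * \<eta>"
    by (simp add: algebra_simps)
  have 4: "\<bar>m / n * X * (1 - q - n * \<epsilon> * H)\<bar> \<le> X * \<bar>1 - q - n * \<epsilon> * H\<bar>"
  proof -
    have "\<bar>m / n * X * (1 - q - n * \<epsilon> * H)\<bar> = (m / n) * (X * \<bar>1 - q - n * \<epsilon> * H\<bar>)"
      using X_ge by (simp add: abs_mult)
    also have "\<dots> \<le> 1 * (X * \<bar>1 - q - n * \<epsilon> * H\<bar>)"
      using X_ge by (intro mult_right_mono) auto
    finally show ?thesis by simp
  qed
  define c where "c = m / n"
  define l where "l = ln P0"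
  have "Tl = t1 - (c * X - m * L * \<delta>) * q" unfolding Tl_def y1_div_p1 by (simp add: q_def c_def)
  moreover have "H * m * (X * \<epsilon>) = c * X * (n * \<epsilon> * H)" by (simp add: c_def)
  \<comment> \<open>The two terms \<open>m * L * \<delta>\<close>, from \<open>t1\<close> and from
    \<open>y1 / p1\<close>, cancel except for the small factor \<open>q - 1\<close>.\<close>
  ultimately have "Tl - Tstar = (t1 - (g \<gamma> - m * ln P0 - m * L * \<delta>))
      + m * L * \<delta> * (q - 1) + m / n * X * (1 - q - n * \<epsilon> * H)"
    unfolding Tstar_def E_def c_def[symmetric] l_def[symmetric] by algebra
  then have "\<bar>Tl - Tstar\<bar> \<le> m * (C\<kappa> * M2 + 2) * \<eta> + m * L * CQ * M2 * \<eta>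
      + M2 * (2 * CP + real n ^ 2 * CQ * M2) * \<eta>"
    by (rule abs_sum3_le[OF _ 1 2 order_trans[OF 4 3]])
  then show ?thesis by (simp only: CT_def distrib_right)
qed

section \<open>Error made by following the tangent line down to the zero\<close>

lemma Tstar_ge: "exp (- Tstar) \<le> exp (- E) * P0 ^ m"
proof -
  have "H * m * (X * \<epsilon>) \<ge> 0" using H_bounds X_ge \<epsilon>_le by simp
  then have "- Tstar \<le> - E + m * ln P0" unfolding Tstar_def by linarith
  then have "exp (- Tstar) \<le> exp (- E + m * ln P0)" by simp
  also have "\<dots> = exp (- E) * P0 ^ m" unfolding exp_add using P0_pos by (simp add: exp_of_nat_mult)
  finally show ?thesis .
qed

lemma CT_nonneg: "CT \<ge> 0"
  using CP_nonneg L \<epsilon>_le unfolding CT_def CQ_def C\<kappa>_def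
  by (intro add_nonneg_nonneg mult_nonneg_nonneg) auto

text \<open>Source of the error term \<open>exp (- E)\<close>. The factor \<open>P0 ^ m\<close> will
  cancel the division by \<open>p1 ^ m\<close>, and \<open>\<eta> \<le> 4\<close> makes the error of
  \<open>Tl\<close> a bounded factor.\<close>

lemma exp_Tl: "exp (- Tl) \<le> exp (4 * CT) * exp (- E) * P0 ^ m"
proof -
  have "CT * \<eta> \<le> CT * 4" using CT_nonneg \<eta>_bounds by (intro mult_left_mono)
  then have "- Tl \<le> 4 * CT + - Tstar" using Tl_approx by linarith
  then have "exp (- Tl) \<le> exp (4 * CT + - Tstar)" by simp
  also have "\<dots> \<le> exp (4 * CT) * (exp (- E) * P0 ^ m)"
    unfolding exp_add by (intro mult_left_mono Tstar_ge) simp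
  finally show ?thesis by (simp add: mult.assoc)
qed

lemma inverse_p1: "P0 ^ m / p1 ^ m \<le> 2 ^ m"
proof -
  have "P0 / p1 \<le> 2" using P_bounds P0_pos unfolding p1_eq by (simp add: divide_le_eq)
  then have "(P0 / p1) ^ m \<le> 2 ^ m" using P0_pos p1_pos by (intro power_mono) auto
  then show ?thesis by (simp add: power_divide)
qed

lemma y1_div_p1_le: "0 \<le> y1 / p1" "y1 / p1 \<le> 2 * X"
proof -
  show "0 \<le> y1 / p1" using y_t1 p1_pos by simp
  have "p1 \<ge> 1 / (2 * G)"
  proof -
    have "1 / G * (1 / 2) \<le> P0 * P" using P0_bounds P_bounds P0_pos by (intro mult_mono) auto
    then show ?thesis unfolding p1_eq by simp
  qed
  then have "y1 / p1 \<le> \<gamma> / (1 / (2 * G))" using y_t1 G_pos p1_pos by (intro frac_le) auto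
  then show "y1 / p1 \<le> 2 * X" by (simp add: X_def)
qed

text \<open>Since \<open>p1 \<le> 4 / G\<close>, the tangent needs at least time
  \<open>u0 * G / 4\<close> to fall from \<open>u0\<close> to \<open>0\<close>; this exponential
  gain beats the polynomial factor \<open>X^2\<close>.\<close>

lemma u0_div_p1: "X\<^sup>2 * exp (- (u0 / p1)) \<le> 1"
proof -
  have "p1 \<le> (2 / G) * 2" using P0_bounds P_bounds P0_pos G_pos unfolding p1_eq by (intro mult_mono) auto
  then have "u0 / (4 / G) \<le> u0 / p1" using u0 p1_pos G_pos by (intro divide_left_mono) auto
  then have "exp (- (u0 / p1)) \<le> exp (- (u0 * G / 4))" by simp
  then have "X\<^sup>2 * exp (- (u0 / p1)) \<le> X\<^sup>2 * exp (- (u0 * G / 4))" by (intro mult_left_mono) auto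
  then show ?thesis using exp_u0 by linarith
qed

definition CB where "CB = exp (4 * CT) * 2 ^ m * (4 * f u0 + M0)"

lemma f_u0: "f u0 > 0" using f_exp[OF u0(1)] by simp

lemma CB_nonneg: "CB \<ge> 0"
  using M0_nonneg f_u0 unfolding CB_def by (intro mult_nonneg_nonneg add_nonneg_nonneg) auto

text \<open>Stated for a general weight \<open>l\<close> because it is applied to both
  \<open>y1 / p1\<close> (slope) and its square (time).\<close>

lemma boundary_term:
  assumes "0 \<le> l" "l \<le> (2 * X)\<^sup>2"
  shows "(A * l + M0 * exp (- Tl)) / p1 ^ m \<le> 2 * exp (- (L * \<delta>)) * l + CB * exp (- E)"
proof -
  have "exp (- (u0 / p1)) * l \<le> exp (- (u0 / p1)) * (2 * X)\<^sup>2" using assms by (intro mult_left_mono) auto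
  also have "\<dots> \<le> 4" using u0_div_p1 by (simp add: power2_eq_square mult_ac)
  finally have "f u0 * (exp (- (u0 / p1)) * l) \<le> f u0 * 4" using f_u0 by (intro mult_left_mono) auto
  then have "(f u0 * (exp (- (u0 / p1)) * l) + M0) * exp (- Tl) \<le> (4 * f u0 + M0) * exp (- Tl)"
    by (intro mult_right_mono) auto
  also have "\<dots> \<le> (4 * f u0 + M0) * (exp (4 * CT) * exp (- E) * P0 ^ m)"
    using f_u0 M0_nonneg by (intro mult_left_mono exp_Tl) auto
  finally have *: "(f u0 * (exp (- (u0 / p1)) * l) + M0) * exp (- Tl)
      \<le> (4 * f u0 + M0) * (exp (4 * CT) * exp (- E) * P0 ^ m)" .
  have "exp (- (Tl + u0 / p1)) = exp (- Tl) * exp (- (u0 / p1))" by (simp add: mult_exp_exp)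
  then have "A * l + M0 * exp (- Tl)
      = F t1 * l + (f u0 * (exp (- (u0 / p1)) * l) + M0) * exp (- Tl)"
    by (simp add: A_def algebra_simps)
  also have "\<dots> \<le> (2 * exp (- (L * \<delta>)) * p1 ^ m) * l + (4 * f u0 + M0) * (exp (4 * CT) * exp (- E) * P0 ^ m)"
    using F_t1_le assms * by (intro add_mono mult_right_mono) auto
  finally have "(A * l + M0 * exp (- Tl)) / p1 ^ m
      \<le> ((2 * exp (- (L * \<delta>)) * p1 ^ m) * l + (4 * f u0 + M0) * (exp (4 * CT) * exp (- E) * P0 ^ m)) / p1 ^ m"
    using p1_pos by (intro divide_right_mono) auto
  also have "\<dots> = 2 * exp (- (L * \<delta>)) * l + (4 * f u0 + M0) * exp (4 * CT) * exp (- E) * (P0 ^ m / p1 ^ m)"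
    using p1_pos by (simp add: add_divide_distrib)
  also have "\<dots> \<le> 2 * exp (- (L * \<delta>)) * l + (4 * f u0 + M0) * exp (4 * CT) * exp (- E) * 2 ^ m"
    using f_u0 M0_nonneg by (intro add_left_mono mult_left_mono inverse_p1) auto
  finally show ?thesis by (simp add: CB_def mult_ac)
qed

lemma T_asymp: "\<bar>T - Tstar\<bar> \<le> (CT + 8) * \<eta> + CB * exp (- E)"
proof -
  have "(y1 / p1)\<^sup>2 \<le> (2 * X)\<^sup>2" using y1_div_p1_le by (intro power_mono) auto
  from boundary_term[OF _ this]
  have "T - Tl \<le> 2 * exp (- (L * \<delta>)) * (y1 / p1)\<^sup>2 + CB * exp (- E)"
    using T_le by simp
  moreover have "2 * exp (- (L * \<delta>)) * (y1 / p1)\<^sup>2 \<le> 8 * \<eta>"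
  proof -
    \<comment> \<open>The fourth power of \<open>X\<close> in \<open>exp_L\<close> absorbs the
      squared outer length and leaves a factor \<open>X^-2\<close>.\<close>
    have "exp (- (L * \<delta>)) * (y1 / p1)\<^sup>2 \<le> (1 / X ^ 4) * (2 * X)\<^sup>2"
      using \<open>(y1 / p1)\<^sup>2 \<le> (2 * X)\<^sup>2\<close> exp_L by (intro mult_mono) auto
    also have "\<dots> = 4 * (1 / X) * (1 / X)" using X_ge by (simp add: field_simps eval_nat_numeral)
    also have "\<dots> \<le> 4 * \<eta> * 1" using X_ge \<eta>_bounds by (intro mult_mono) auto
    finally show ?thesis by simp
  qed
  ultimately show ?thesis using Tl_approx Tl_le unfolding distrib_right by linarith
qed

lemma p_asymp:
  "\<bar>p T - P0 * (1 + n * \<epsilon> * H)\<bar> \<le> (2 * CP + 16 / c2 + 4 * CB) * (\<epsilon> * \<eta> / G + exp (- E) / G)"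
proof -
  have pm: "p1 ^ m = p1 * p1 ^ (m - 1)" using m_pos by (cases m) auto
  have p1_le: "p1 \<le> 4 / G"
  proof -
    have "p1 \<le> (2 / G) * 2" using P0_bounds P_bounds P0_pos G_pos unfolding p1_eq by (intro mult_mono) auto
    then show ?thesis by simp
  qed
  have "2 * X \<le> (2 * X)\<^sup>2" using X_ge by (simp add: power2_eq_square)
  then have l: "y1 / p1 \<le> (2 * X)\<^sup>2" using y1_div_p1_le by linarith
  have "exp (- (L * \<delta>)) * (y1 / p1) \<le> (1 / X ^ 4) * (2 * X)"
    using y1_div_p1_le exp_L by (intro mult_mono) auto
  also have "\<dots> = 2 * (1 / X ^ 3)" using X_ge by (simp add: field_simps eval_nat_numeral)
  also have "1 / X ^ 3 \<le> 1 / X\<^sup>2" using X_ge by (intro divide_left_mono power_increasing) auto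
  also have "\<dots> \<le> \<epsilon> * \<eta> / c2" by (rule inverse_X2)
  finally have 1: "2 * exp (- (L * \<delta>)) * (y1 / p1) \<le> 4 * (\<epsilon> * \<eta> / c2)" by simp
  have "p T - p1 \<le> (A * (y1 / p1) + M0 * exp (- Tl)) / p1 ^ (m - 1)" using p_T_bounds by simp
  \<comment> \<open>Trading \<open>p1 ^ (m - 1)\<close> for \<open>p1 ^ m\<close> leaves a factor
    \<open>p1\<close>, which supplies the \<open>1 / G\<close> in both error terms.\<close>
  also have "\<dots> = p1 * ((A * (y1 / p1) + M0 * exp (- Tl)) / p1 ^ m)" using p1_pos by (simp add: pm)
  also have "\<dots> \<le> p1 * (4 * (\<epsilon> * \<eta> / c2) + CB * exp (- E))"
    using boundary_term[OF y1_div_p1_le(1) l] 1 p1_pos by (intro mult_left_mono) linarith+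
  also have "\<dots> \<le> (4 / G) * (4 * (\<epsilon> * \<eta> / c2) + CB * exp (- E))"
    using \<epsilon>_le \<eta>_bounds c2 CB_nonneg by (intro mult_right_mono p1_le) auto
  also have "\<dots> = 16 / c2 * (\<epsilon> * \<eta> / G) + 4 * CB * (exp (- E) / G)" by (simp add: algebra_simps)
  finally have 2: "p T - p1 \<le> 16 / c2 * (\<epsilon> * \<eta> / G) + 4 * CB * (exp (- E) / G)" .
  have "p1 - P0 * (1 + n * \<epsilon> * H) = P0 * (P - 1 - n * \<epsilon> * H)" unfolding p1_eq by (simp add: algebra_simps)
  then have "\<bar>p1 - P0 * (1 + n * \<epsilon> * H)\<bar> = P0 * \<bar>P - 1 - n * \<epsilon> * H\<bar>" using P0_pos by (simp add: abs_mult)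
  also have "\<dots> \<le> (2 / G) * (CP * (\<epsilon> * \<eta>))" using G_pos by (intro mult_mono P0_bounds slope) auto
  also have "\<dots> = 2 * CP * (\<epsilon> * \<eta> / G)" by simp
  finally have 3: "\<bar>p1 - P0 * (1 + n * \<epsilon> * H)\<bar> \<le> 2 * CP * (\<epsilon> * \<eta> / G)" .
  define u v where "u = \<epsilon> * \<eta> / G" and "v = exp (- E) / G"
  have uv: "u \<ge> 0" "v \<ge> 0" using \<epsilon>_le \<eta>_bounds G_pos by (auto simp: u_def v_def)
  have "\<bar>p T - P0 * (1 + n * \<epsilon> * H)\<bar> \<le> (2 * CP + 16 / c2) * u + 4 * CB * v"
    using 2 3 p_T_bounds(1) unfolding u_def[symmetric] v_def[symmetric] distrib_right by linarith
  also have "\<dots> \<le> (2 * CP + 16 / c2 + 4 * CB) * u + (2 * CP + 16 / c2 + 4 * CB) * v"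
  proof (rule add_mono[OF mult_right_mono mult_right_mono])
    have "16 / c2 \<ge> 0" using c2 by simp
    then show "4 * CB \<le> 2 * CP + 16 / c2 + 4 * CB" using CP_nonneg by linarith
  qed (use uv CB_nonneg in auto)
  finally show ?thesis unfolding u_def v_def by (simp only: distrib_left)
qed

text \<open>One constant for both expansions, built only from parameters that stay fixed as
  \<open>\<gamma>\<close> varies.\<close>

definition C_total where "C_total = 2 * CP + 16 / c2 + 4 * CB + CT + 8"

lemma p_expansion:
  "\<bar>p T - (n / m * (1 / G) + real n ^ 2 * harm n * g2 \<gamma> / (m * G ^ 3))\<bar>
    \<le> C_total * (\<delta>\<^sup>2 * g2 \<gamma> / G ^ 4 + exp (- (g \<gamma> - m / n * \<gamma> * G)) / G)"
proof -
  have 1: "P0 * (1 + n * \<epsilon> * H) = n / m * (1 / G) + real n ^ 2 * harm n * g2 \<gamma> / (m * G ^ 3)"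
    by (simp add: P0_def \<epsilon>_def power2_eq_square power3_eq_cube distrib_left mult_ac del: of_nat_Suc)
  have 2: "\<epsilon> * \<eta> / G = \<delta>\<^sup>2 * g2 \<gamma> / G ^ 4"
    using G_pos by (simp add: \<epsilon>_def \<eta>_def power2_eq_square power4_eq_xxxx)
  have 3: "E = g \<gamma> - m / n * \<gamma> * G" unfolding E_def unfolding X_def by simp
  have "0 \<le> \<epsilon> * \<eta> / G + exp (- E) / G"
    using \<epsilon>_le \<eta>_bounds G_pos by (intro add_nonneg_nonneg divide_nonneg_nonneg mult_nonneg_nonneg) auto
  moreover have "2 * CP + 16 / c2 + 4 * CB \<le> C_total" using CT_nonneg unfolding C_total_def by linarith
  ultimately have "(2 * CP + 16 / c2 + 4 * CB) * (\<epsilon> * \<eta> / G + exp (- E) / G)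
      \<le> C_total * (\<epsilon> * \<eta> / G + exp (- E) / G)" by (intro mult_right_mono)
  with p_asymp show ?thesis unfolding 1 2 3 by (rule order_trans)
qed

lemma T_expansion:
  "\<bar>T - ((g \<gamma> - m / n * \<gamma> * G) + m * ln (m / n * G) + harm n * m * \<gamma> * g2 \<gamma> / G)\<bar>
    \<le> C_total * (\<delta>\<^sup>2 / G + exp (- (g \<gamma> - m / n * \<gamma> * G)))"
proof -
  have E: "E = g \<gamma> - m / n * \<gamma> * G" unfolding E_def unfolding X_def by simp
  have "ln P0 = - ln (m / n * G)"
  proof -
    have "P0 = inverse (m / n * G)" by (simp add: P0_def)
    moreover have "m / n * G > 0" using G_pos m_pos by (intro mult_pos_pos) auto
    ultimately show ?thesis by (simp only: ln_inverse)
  qed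
  then have 1: "Tstar = E + m * ln (m / n * G) + harm n * m * \<gamma> * g2 \<gamma> / G"
    unfolding Tstar_def X_times_\<epsilon> by simp
  have "16 / c2 \<ge> 0" using c2 by simp
  then have "CT + 8 \<le> C_total" "CB \<le> C_total"
    using CP_nonneg CB_nonneg CT_nonneg unfolding C_total_def by linarith+
  then have "(CT + 8) * \<eta> + CB * exp (- E) \<le> C_total * \<eta> + C_total * exp (- E)"
    using \<eta>_bounds by (intro add_mono mult_right_mono) auto
  with T_asymp have "\<bar>T - Tstar\<bar> \<le> C_total * \<eta> + C_total * exp (- E)" by (rule order_trans)
  then show ?thesis unfolding 1 distrib_left[symmetric] unfolding E \<eta>_def .
qed

lemma C_total_nonneg: "C_total \<ge> 0"
proof -
  have "16 / c2 \<ge> 0" using c2 by simp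
  then show ?thesis using CP_nonneg CB_nonneg CT_nonneg unfolding C_total_def by linarith
qed

end

section \<open>Asymptotics of the nonlinearity\<close>

lemma half_less_self: "r / 2 < r" and less_double_self: "r < 2 * r" if "r > 0" for r :: real
  using that by auto

text \<open>Extracts from (H1) the power growth of \<open>g'\<close>, \<open>g''\<close> and
  \<open>g'''\<close>. The limit \<open>l3\<close> may be zero or negative, so only
  \<open>\<bar>g3\<bar>\<close> is ever bounded.\<close>

locale regular_growth =
  fixes g1 g2 g3 :: "real \<Rightarrow> real" and q l1 l2 l3 :: real
  assumes q: "1 < q" "q \<le> 2" and l1: "l1 > 0" and l2: "l2 > 0"
    and g1_lim: "((\<lambda>u. g1 u / u powr (q - 1)) \<longlongrightarrow> l1) at_top"
    and g2_lim: "((\<lambda>u. g2 u / u powr (q - 2)) \<longlongrightarrow> l2) at_top"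
    and g3_lim: "((\<lambda>u. g3 u / u powr (q - 3)) \<longlongrightarrow> l3) at_top"
    and g2_deriv: "\<And>u. u > 0 \<Longrightarrow> (g2 has_real_derivative g3 u) (at u)"
begin

lemma g1_bounds: "\<forall>\<^sub>F u in at_top. l1 / 2 * u powr (q - 1) \<le> g1 u \<and> g1 u \<le> 2 * l1 * u powr (q - 1)"
proof -
  have "\<forall>\<^sub>F u in at_top. g1 u / u powr (q - 1) > l1 / 2" "\<forall>\<^sub>F u in at_top. g1 u / u powr (q - 1) < 2 * l1"
    using l1 by (intro order_tendstoD[OF g1_lim]; simp)+
  then show ?thesis
    using eventually_gt_at_top[of 0] by eventually_elim (auto simp: field_simps)
qed

lemma g2_lower: "\<forall>\<^sub>F u in at_top. l2 / 2 * u powr (q - 2) \<le> g2 u"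
proof -
  have "\<forall>\<^sub>F u in at_top. g2 u / u powr (q - 2) > l2 / 2"
    using l2 by (intro order_tendstoD[OF g2_lim]; simp)
  then show ?thesis
    using eventually_gt_at_top[of 0] by eventually_elim (auto simp: field_simps)
qed

lemma g3_bound: "\<forall>\<^sub>F u in at_top. \<bar>g3 u\<bar> \<le> (\<bar>l3\<bar> + 1) * u powr (q - 3)"
proof -
  have "\<forall>\<^sub>F u in at_top. \<bar>g3 u / u powr (q - 3)\<bar> < \<bar>l3\<bar> + 1"
    by (rule order_tendstoD[OF tendsto_rabs[OF g3_lim]]) simp
  then show ?thesis
    using eventually_gt_at_top[of 0] by eventually_elim (auto simp: field_simps abs_divide)
qed

lemma g1_top: "filterlim g1 at_top at_top"
proof (rule filterlim_at_top_mono)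
  show "filterlim (\<lambda>u. l1 / 2 * u powr (q - 1)) at_top at_top" using q l1 by real_asymp
  show "\<forall>\<^sub>F u in at_top. l1 / 2 * u powr (q - 1) \<le> g1 u"
    using g1_bounds by eventually_elim simp
qed

lemma ratio_lim: "((\<lambda>u. u * g2 u / g1 u) \<longlongrightarrow> l2 / l1) at_top"
proof -
  have "((\<lambda>u. (g2 u / u powr (q - 2)) / (g1 u / u powr (q - 1))) \<longlongrightarrow> l2 / l1) at_top"
    using l1 by (intro tendsto_divide g2_lim g1_lim) simp
  moreover have "\<forall>\<^sub>F u in at_top. (g2 u / u powr (q - 2)) / (g1 u / u powr (q - 1)) = u * g2 u / g1 u"
    using eventually_gt_at_top[of 0]
  proof eventually_elim
    case (elim u)
    have "u powr (q - 1) = u powr (q - 2) * u"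
      using elim powr_mult_base[of u "q - 2"] by (simp add: mult.commute)
    then show ?case using elim by simp
  qed
  ultimately show ?thesis by (simp add: tendsto_cong)
qed

text \<open>Chosen so that \<open>ln u \<le> s * ln (g1 u)\<close> for large \<open>u\<close>: half
  of the exponent \<open>q - 1\<close> is spent on absorbing the constant
  \<open>l1 / 2\<close>.\<close>

definition s where "s = 2 / (q - 1)"

lemma s_pos: "s > 0" using q by (simp add: s_def)

lemma ln_le_s: "\<forall>\<^sub>F u in at_top. ln u \<le> s * ln (g1 u)"
proof -
  have "\<forall>\<^sub>F u in at_top. u powr ((q - 1) / 2) \<le> l1 / 2 * u powr (q - 1)"
    using q l1 by real_asymp
  then show ?thesis using g1_bounds eventually_gt_at_top[of 0]
  proof eventually_elim
    case (elim u)
    then have "u powr ((q - 1) / 2) \<le> g1 u" by linarith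
    moreover have "u powr ((q - 1) / 2) > 0" using elim by simp
    ultimately have "ln (u powr ((q - 1) / 2)) \<le> ln (g1 u)" by (intro ln_mono) linarith+
    then have "(q - 1) / 2 * ln u \<le> ln (g1 u)" using elim by (simp add: ln_powr)
    then have "s * ((q - 1) / 2 * ln u) \<le> s * ln (g1 u)" using s_pos by (intro mult_left_mono) auto
    then show ?case using q by (simp add: s_def)
  qed
qed

lemma ln_g1_le: "\<forall>\<^sub>F u in at_top. ln (g1 u) \<le> u"
proof -
  have "\<forall>\<^sub>F u in at_top. 2 * l1 * u powr (q - 1) \<le> exp u" using q l1 by real_asymp
  then show ?thesis using g1_bounds eventually_gt_at_top[of 0]
  proof eventually_elim
    case (elim u)
    have "l1 / 2 * u powr (q - 1) > 0" using elim l1 by simp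
    then have "g1 u > 0" "g1 u \<le> exp u" using elim by linarith+
    then have "ln (g1 u) \<le> ln (exp u)" by (intro ln_mono) auto
    then show ?case by simp
  qed
qed

lemma ln_squared_le: "(ln x)\<^sup>2 \<le> 4 * x" if "x \<ge> 1" for x :: real
proof -
  have "ln x = 2 * ln (sqrt x)" using that by (simp add: ln_sqrt)
  also have "\<dots> \<le> 2 * sqrt x" using ln_le_minus_one[of "sqrt x"] that by simp
  finally have "(ln x)\<^sup>2 \<le> (2 * sqrt x)\<^sup>2" using that by (intro power_mono) auto
  then show ?thesis using that by (simp add: power_mult_distrib)
qed

definition M3 where "M3 = (\<bar>l3\<bar> + 1) * (1 / 2) powr (q - 3) * (2 / l2)"

lemma M3_nonneg: "M3 \<ge> 0" using l2 by (simp add: M3_def)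

text \<open>By the mean value theorem, with \<open>g'''\<close> of order at most
  \<open>v powr (q - 3)\<close> and \<open>g''\<close> of order at least
  \<open>v powr (q - 2)\<close>. In \<open>M3\<close>, the power of \<open>1 / 2\<close> comes from
  evaluating the decreasing power at \<open>v / 2\<close>, and \<open>2 / l2\<close> converts
  \<open>v powr (q - 2)\<close> into \<open>g2 v\<close>.\<close>

lemma g2_variation:
  "\<forall>\<^sub>F v in at_top. \<forall>u. v / 2 \<le> u \<longrightarrow> u \<le> v \<longrightarrow> \<bar>g2 v - g2 u\<bar> \<le> (v - u) * (M3 * g2 v / v)"
proof -
  obtain b where b: "\<And>u. u \<ge> b \<Longrightarrow> \<bar>g3 u\<bar> \<le> (\<bar>l3\<bar> + 1) * u powr (q - 3)"
    using g3_bound unfolding eventually_at_top_linorder by blast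
  show ?thesis using g2_lower eventually_ge_at_top[of "2 * b"] eventually_gt_at_top[of 0]
  proof eventually_elim
    case (elim v)
    show ?case
    proof (intro allI impI)
      fix u assume u: "v / 2 \<le> u" "u \<le> v"
      show "\<bar>g2 v - g2 u\<bar> \<le> (v - u) * (M3 * g2 v / v)"
      proof (cases "u = v")
        case False
        then have "u < v" using u by simp
        moreover have "(g2 has_real_derivative g3 x) (at x)" if "u \<le> x" for x
          using that u elim by (intro g2_deriv) linarith
        ultimately obtain x where x: "u < x" "x < v" "g2 v - g2 u = (v - u) * g3 x"
          using MVT2[of u v g2 g3] by blast
        have "\<bar>g3 x\<bar> \<le> (\<bar>l3\<bar> + 1) * x powr (q - 3)" using x u elim by (intro b) linarith
        also have "\<dots> \<le> (\<bar>l3\<bar> + 1) * (v / 2) powr (q - 3)"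
          using x u elim q by (intro mult_left_mono powr_mono2') auto
        also have "(v / 2) powr (q - 3) = (1 / 2) powr (q - 3) * v powr (q - 3)"
          using elim powr_mult[of "1 / 2" v "q - 3"] by simp
        also have "v powr (q - 3) = v powr (q - 2) / v"
          using elim powr_mult_base[of v "q - 3"] by (simp add: field_simps)
        also have "(\<bar>l3\<bar> + 1) * ((1 / 2) powr (q - 3) * (v powr (q - 2) / v))
            = M3 * (l2 / 2 * v powr (q - 2)) / v"
          using l2 by (simp add: M3_def)
        also have "\<dots> \<le> M3 * g2 v / v"
          using elim M3_nonneg by (intro divide_right_mono mult_left_mono) auto
        finally have "(v - u) * \<bar>g3 x\<bar> \<le> (v - u) * (M3 * g2 v / v)"
          using u by (intro mult_left_mono) auto
        then show ?thesis using x u by (simp add: abs_mult)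
      qed simp
    qed
  qed
qed

section \<open>Constants independent of \<gamma> and the range of large \<gamma>\<close>

definition c2 where "c2 = l2 / l1 / 2"
definition M2 where "M2 = 2 * (l2 / l1)"
text \<open>\<open>ln X \<le> (s + 1) * \<delta>\<close>, so four times \<open>s + 1\<close> yields
  \<open>exp (- (L * \<delta>)) \<le> 1 / X ^ 4\<close>.\<close>

definition L where "L = 4 * (s + 1)"
text \<open>Makes \<open>x\<close> the bound of \<open>g2_variation\<close> at the matching point:
  \<open>M3 * (v - y1) / v = Cx n * \<delta> / X\<close>.\<close>

definition Cx where "Cx n = M3 * real n * L"

lemma constants: "c2 > 0" "M2 > 0" "L \<ge> 1" "Cx n \<ge> 0"
  using l1 l2 s_pos M3_nonneg by (auto simp: c2_def M2_def L_def Cx_def)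

text \<open>Collects every condition of \<open>shooting_asymp\<close> on \<gamma> that does not
  mention a solution, so that one threshold serves all solutions.\<close>

definition regime :: "nat \<Rightarrow> real \<Rightarrow> real \<Rightarrow> bool" where
  "regime n u0 v \<longleftrightarrow> (let G = g1 v; \<delta> = ln G; X = v * G; x = Cx n * \<delta> / X; y1 = v - n * (L * \<delta>) / G in
     v > 0 \<and> G > 0 \<and> 1 \<le> \<delta> \<and> \<delta> \<le> v \<and> \<delta>\<^sup>2 \<le> 4 * G \<and>
     c2 \<le> v * g2 v / G \<and> v * g2 v / G \<le> M2 \<and> g2 v \<ge> 0 \<and>
     exp (- (L * \<delta>)) \<le> 1 / X ^ 4 \<and> 4 * real n * exp (- (L * \<delta>)) \<le> 1 \<and> 0 \<le> x \<and> x \<le> 1 / 2 \<and>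
     8 * real n * (g2 v * (1 + x) * (v - y1)\<^sup>2) \<le> 1 \<and> 4 * real n * L * M2 * \<delta> \<le> X \<and>
     X\<^sup>2 * exp (- (u0 * G / 4)) \<le> 1 \<and> y1 > 0 \<and> u0 \<le> y1 \<and> y1 < v \<and>
     (\<forall>u. y1 \<le> u \<longrightarrow> u \<le> v \<longrightarrow> g2 v * (1 - x) \<le> g2 u \<and> g2 u \<le> g2 v * (1 + x)))"

lemma regime_eventually:
  assumes n: "n > 0" and u0: "u0 > 0"
  shows "\<forall>\<^sub>F v in at_top. regime n u0 v"
proof -
  \<comment> \<open>A sum of nonnegative thresholds plus \<open>1\<close>, so that
    \<open>v \<ge> k\<close> implies each of them separately.\<close>
  define k where "k = 2 * u0 + 4 * real n + 8 * Cx n + 16 * real n * L * (M2 + 1)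
    + 64 * real n ^ 3 * L\<^sup>2 * M2 + 1"
  have 1: "\<forall>\<^sub>F v in at_top. g1 v \<ge> exp 1"
    using g1_top by (simp add: filterlim_at_top)
  have "l2 / l1 > 0" using l1 l2 by simp
  then have "c2 < l2 / l1" "l2 / l1 < M2" unfolding c2_def M2_def
    by (simp_all only: half_less_self less_double_self)
  note 2 = order_tendstoD(1)[OF ratio_lim this(1)] order_tendstoD(2)[OF ratio_lim this(2)]
  have 3: "\<forall>\<^sub>F v in at_top. 2 * (s + 1) * ln (g1 v) \<le> u0 * g1 v / 4"
  proof -
    have "\<forall>\<^sub>F G in at_top. 2 * (s + 1) * ln G \<le> u0 * G / 4" using u0 s_pos by real_asymp
    then show ?thesis by (rule eventually_compose_filterlim[OF _ g1_top])
  qed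
  show ?thesis
    using 1 2 3 ln_le_s ln_g1_le g2_variation g2_lower eventually_ge_at_top[of k]
  proof eventually_elim
    case (elim v)
    define G \<delta> X where "G = g1 v" and "\<delta> = ln G" and "X = v * G"
    define x y1 where "x = Cx n * \<delta> / X" and "y1 = v - n * (L * \<delta>) / G"
    have pos: "2 * u0 \<ge> 0" "4 * real n \<ge> 0" "8 * Cx n \<ge> 0" "16 * real n * L * (M2 + 1) \<ge> 0"
      "64 * real n ^ 3 * L\<^sup>2 * M2 \<ge> 0"
      using u0 constants(1-3) constants(4)[of n] by auto
    then have k: "v \<ge> 1" "v \<ge> 2 * u0" "v \<ge> 4 * real n" "v \<ge> 8 * Cx n" "v \<ge> 16 * real n * L * (M2 + 1)"
      "v \<ge> 64 * real n ^ 3 * L\<^sup>2 * M2"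
      using elim(9) unfolding k_def by linarith+
    have G1: "G \<ge> exp 1" using elim(1) by (simp add: G_def)
    then have G: "G > 0" "G \<ge> 1" using exp_ge_add_one_self[of "1::real"] by linarith+
    have \<delta>: "1 \<le> \<delta>" unfolding \<delta>_def using ln_mono[OF G1] by simp
    have \<delta>G: "\<delta>\<^sup>2 \<le> 4 * G" unfolding \<delta>_def by (rule ln_squared_le[OF G(2)])
    have X: "X \<ge> v" "X \<ge> 1" "X > 0"
    proof -
      show "X \<ge> v" unfolding X_def using G k by simp
      then show "X \<ge> 1" "X > 0" using k by linarith+
    qed
    \<comment> \<open>From here a fixed multiple of \<open>\<delta>\<close> or
      \<open>\<delta>^2\<close> is below \<open>X\<close> as soon as \<open>v\<close> exceeds a
      fixed constant; all smallness conditions up to \<open>\<kappa>\<close> follow this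
      pattern.\<close>
    have v\<delta>: "v * \<delta>\<^sup>2 \<le> 4 * X" unfolding X_def using mult_left_mono[OF \<delta>G, of v] k by simp
    have "v * \<delta> \<le> v * \<delta>\<^sup>2"
      using self_le_power[of \<delta> 2] \<delta> k by (intro mult_left_mono) auto
    then have v\<delta>1: "v * \<delta> \<le> 4 * X" using v\<delta> by linarith
    have x_le: "x \<le> 1 / 2" "0 \<le> x"
    proof -
      have "8 * Cx n * \<delta> \<le> v * \<delta>" using k \<delta> by (intro mult_right_mono) auto
      then have "2 * (Cx n * \<delta>) \<le> X" using v\<delta>1 by linarith
      then show "x \<le> 1 / 2" unfolding x_def using X by (simp add: divide_le_eq)
      show "0 \<le> x" unfolding x_def using constants(4)[of n] \<delta> X by simp
    qed
    have LM: "4 * real n * L * (M2 + 1) * \<delta> \<le> X"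
    proof -
      have "16 * real n * L * (M2 + 1) * \<delta> \<le> v * \<delta>" using k \<delta> by (intro mult_right_mono) auto
      then show ?thesis using v\<delta>1 by (simp add: mult.assoc)
    qed
    have L1: "4 * real n * L * M2 * \<delta> \<le> X" "4 * real n * L * \<delta> \<le> X"
    proof -
      have nL: "0 \<le> 4 * real n * L" using constants by simp
      have "4 * real n * L * M2 * \<delta> \<le> 4 * real n * L * (M2 + 1) * \<delta>"
        "4 * real n * L * 1 * \<delta> \<le> 4 * real n * L * (M2 + 1) * \<delta>"
        using constants \<delta> nL by (intro mult_right_mono mult_left_mono; simp)+
      then show "4 * real n * L * M2 * \<delta> \<le> X" "4 * real n * L * \<delta> \<le> X" using LM by auto
    qed
    have d: "0 < v - y1" "v - y1 \<le> v / 2"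
    proof -
      show "0 < v - y1" unfolding y1_def using n constants \<delta> G by simp
      have "4 * (real n * L * \<delta>) \<le> v * G" using L1(2) unfolding X_def by (simp add: mult.assoc)
      moreover have "0 \<le> v * G" using k G by simp
      ultimately have "real n * (L * \<delta>) \<le> v / 2 * G" by (simp add: mult.assoc)
      then show "v - y1 \<le> v / 2" unfolding y1_def using G by (simp add: divide_le_eq)
    qed
    have g2v: "g2 v > 0"
    proof -
      have "0 < l2 / 2 * v powr (q - 2)" using l2 k by simp
      then show ?thesis using elim(8) by linarith
    qed
    have M2: "v * g2 v / G \<le> M2" "c2 \<le> v * g2 v / G" using elim(2,3) unfolding G_def by auto
    have lnX: "ln X \<le> (s + 1) * \<delta>"
    proof -
      have "ln X = ln v + \<delta>" unfolding X_def \<delta>_def using k G by (simp add: ln_mult_pos)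
      then show ?thesis using elim(5) unfolding G_def[symmetric] \<delta>_def[symmetric] by (simp add: distrib_right)
    qed
    have expL: "exp (- (L * \<delta>)) \<le> 1 / X ^ 4"
    proof -
      have "- (L * \<delta>) \<le> - (real 4 * ln X)" 
      unfolding L_def mult.assoc neg_le_iff_le of_nat_numeral by (rule mult_left_mono[OF lnX]) simp
      then have "exp (- (L * \<delta>)) \<le> exp (- (real 4 * ln X))" by (simp only: exp_le_cancel_iff)
      also have "\<dots> = 1 / X ^ 4" using X by (simp only: exp_minus exp_of_nat_mult exp_ln inverse_eq_divide)
      finally show ?thesis .
    qed
    have expL4: "4 * real n * exp (- (L * \<delta>)) \<le> 1"
    proof -
      have "X ^ 1 \<le> X ^ 4" using X by (intro power_increasing) auto
      then have "1 / X ^ 4 \<le> 1 / X" using X by (intro divide_left_mono) auto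
      also have "\<dots> \<le> 1 / v" using X k by (intro divide_left_mono) auto
      finally have "exp (- (L * \<delta>)) \<le> 1 / v" using expL by linarith
      then have "4 * real n * exp (- (L * \<delta>)) \<le> v * (1 / v)" using k by (intro mult_mono) auto
      then show ?thesis using k by simp
    qed
    have expu: "X\<^sup>2 * exp (- (u0 * G / 4)) \<le> 1"
    proof -
      have "2 * ln X \<le> 2 * (s + 1) * \<delta>" unfolding mult.assoc by (rule mult_left_mono[OF lnX]) simp
      also have "\<dots> \<le> u0 * G / 4" using elim(4) unfolding G_def[symmetric] \<delta>_def[symmetric] .
      finally have *: "2 * ln X \<le> u0 * G / 4" .
      have "X\<^sup>2 * exp (- (u0 * G / 4)) = exp (real 2 * ln X + - (u0 * G / 4))"
        unfolding exp_add using X by (simp only: exp_of_nat_mult exp_ln)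
      also have "\<dots> \<le> exp 0"
        unfolding exp_le_cancel_iff using * by simp
      finally show ?thesis by simp
    qed
    have \<kappa>: "8 * real n * (g2 v * (1 + x) * (v - y1)\<^sup>2) \<le> 1"
    proof -
      have "g2 v * (1 + x) * (v - y1)\<^sup>2 \<le> g2 v * 2 * (v - y1)\<^sup>2"
        using g2v x_le by (intro mult_right_mono mult_left_mono) auto
      also have "\<dots> = 2 * real n ^ 2 * L\<^sup>2 * ((v * g2 v / G) * (\<delta>\<^sup>2 / X))"
        unfolding y1_def X_def using k G by (simp add: power2_eq_square field_simps)
      also have "\<dots> \<le> 2 * real n ^ 2 * L\<^sup>2 * (M2 * (\<delta>\<^sup>2 / X))"
        using M2 X by (intro mult_left_mono mult_right_mono) auto
      finally have "8 * real n * (g2 v * (1 + x) * (v - y1)\<^sup>2)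
          \<le> 8 * real n * (2 * real n ^ 2 * L\<^sup>2 * (M2 * (\<delta>\<^sup>2 / X)))" by (intro mult_left_mono) auto
      also have "\<dots> = (64 * real n ^ 3 * L\<^sup>2 * M2 * \<delta>\<^sup>2) / (4 * X)"
        by (simp add: power2_eq_square power3_eq_cube)
      also have "\<dots> \<le> 1"
      proof -
        have "64 * real n ^ 3 * L\<^sup>2 * M2 * \<delta>\<^sup>2 \<le> v * \<delta>\<^sup>2" using k by (intro mult_right_mono) auto
        then have "64 * real n ^ 3 * L\<^sup>2 * M2 * \<delta>\<^sup>2 \<le> 4 * X" using v\<delta> by (rule order_trans)
        then show ?thesis using X by (simp only: divide_le_eq_1) simp
      qed
      finally show ?thesis .
    qed
    have var: "g2 v * (1 - x) \<le> g2 u \<and> g2 u \<le> g2 v * (1 + x)" if "y1 \<le> u" "u \<le> v" for u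
    proof -
      have "\<bar>g2 v - g2 u\<bar> \<le> (v - u) * (M3 * g2 v / v)" using elim(7)[rule_format, of u] that d by simp
      also have "\<dots> \<le> (v - y1) * (M3 * g2 v / v)"
        using that g2v k M3_nonneg by (intro mult_right_mono) auto
      also have "\<dots> = g2 v * x" unfolding y1_def x_def X_def Cx_def by (simp add: mult_ac)
      finally show ?thesis by (simp add: abs_le_iff algebra_simps)
    qed
    have "0 < v" "\<delta> \<le> v" "0 < y1" "u0 \<le> y1" "y1 < v"
      using k d elim(6) unfolding G_def[symmetric] \<delta>_def[symmetric] by auto
    then show ?case
      using G \<delta> \<delta>G M2 g2v expL expL4 x_le \<kappa> L1 expu var
      unfolding regime_def Let_def G_def[symmetric] \<delta>_def[symmetric] X_def[symmetric]
        x_def[symmetric] y1_def[symmetric]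
      by (intro conjI allI impI) (simp_all only: less_imp_le)
  qed
qed

lemma shooting_asymp_regime:
  assumes sh: "shooting m f g g1 g2 v y p T" and reg: "regime (Suc m) u0 v"
    and u0: "u0 > 0" "\<And>u. u \<ge> u0 \<Longrightarrow> g1 u \<ge> 0" "\<And>u. u \<ge> u0 \<Longrightarrow> g2 u \<ge> 0"
    and M0: "\<And>u. 0 \<le> u \<Longrightarrow> u \<le> u0 \<Longrightarrow> f u \<le> M0"
  shows "\<exists>t1 lo N X \<epsilon> \<eta> x. shooting_asymp m f g g1 g2 v y p T t1 lo N u0 M0 L M2 c2
    (Cx (Suc m)) (ln (g1 v)) X \<epsilon> \<eta> x"
proof -
  interpret shooting m f g g1 g2 v y p T by (rule sh)
  define G \<delta> X where "G = g1 v" and "\<delta> = ln G" and "X = v * G"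
  define x y1 where "x = Cx n * \<delta> / X" and "y1 = v - n * (L * \<delta>) / G"
  note r = reg[unfolded regime_def Let_def, folded G_def, folded \<delta>_def X_def, folded x_def y1_def]
  obtain t1 where hit: "t1 > T" "y t1 = y1" using reaches[of y1] r by blast
  have g2: "g2 v * (1 - x) \<ge> 0" using r by (intro mult_nonneg_nonneg) auto
  interpret shooting_inner m f g g1 g2 v y p T t1 "g2 v * (1 - x)" "g2 v * (1 + x)"
  proof unfold_locales
    show "g2 v * (1 - x) \<le> g2 u \<and> g2 u \<le> g2 v * (1 + x)" if "y t1 \<le> u" "u \<le> v" for u
      using r that unfolding hit(2) by blast
    show "g1 v > 0" using r unfolding G_def[symmetric] by blast
  qed fact+
  interpret shooting_outer m f g g1 g2 v y p T t1 u0 M0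
  proof unfold_locales
    show "u0 \<le> y t1" using r unfolding hit(2) by blast
  qed (use hit u0 M0 in auto)
  have \<kappa>: "\<kappa> = g2 v * (1 + x) * (v - y1)\<^sup>2" by (simp add: \<kappa>_def hit)
  have "shooting_asymp m f g g1 g2 v y p T t1 (g2 v * (1 - x)) (g2 v * (1 + x)) u0 M0 L M2 c2
    (Cx n) \<delta> X (g2 v / G\<^sup>2) (\<delta>\<^sup>2 / G) x"
  proof unfold_locales
    show "8 * real n * \<kappa> \<le> 1" unfolding \<kappa> using r by blast
    show "real (4 * n) * L * M2 * \<delta> \<le> X" using r by simp
  qed (use r constants in \<open>auto simp: G_def \<delta>_def X_def x_def y1_def hit\<close>)
  then show ?thesis unfolding \<delta>_def G_def by blast
qed

end

text \<open>\<open>g\<close> is tied to its formula only on the positive axis; openness of that set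
  still identifies its iterated \<open>deriv\<close> there.\<close>

lemma deriv_eq_on_pos:
  fixes h k k' :: "real \<Rightarrow> real"
  assumes "\<And>u. u > 0 \<Longrightarrow> h u = k u" "\<And>u. u > 0 \<Longrightarrow> (k has_real_derivative k' u) (at u)" "u > 0"
  shows "(h has_real_derivative k' u) (at u)" "deriv h u = k' u"
proof -
  show "(h has_real_derivative k' u) (at u)"
    by (rule has_field_derivative_transform_within_open[OF assms(2)[OF assms(3)], of "{0<..}"])
      (use assms in auto)
  then show "deriv h u = k' u" by (rule DERIV_imp_deriv)
qed

lemma powr_deriv_pos: "((\<lambda>u. c * u powr e) has_real_derivative c * e * u powr (e - 1)) (at u)"
  if "u > 0" for c e u :: real
  using DERIV_cmult[OF has_real_derivative_powr[OF that], of c e] by (simp add: mult.assoc)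

lemma Ck_on_deriv:
  assumes "Ck_on k S h" "j < k" "u \<in> S"
  shows "((deriv ^^ j) h has_real_derivative (deriv ^^ Suc j) h u) (at u)"
  using assms by (auto simp: Ck_on_def DERIV_deriv_iff_real_differentiable)

lemma continuous_on_bounded_above:
  fixes f :: "real \<Rightarrow> real"
  assumes "continuous_on {0..} f"
  shows "\<exists>M. \<forall>u. 0 \<le> u \<longrightarrow> u \<le> b \<longrightarrow> f u \<le> M"
proof -
  have "bounded (f ` {0..b})"
    by (intro compact_imp_bounded compact_continuous_image continuous_on_subset[OF assms]) auto
  then obtain M where "\<And>x. x \<in> f ` {0..b} \<Longrightarrow> norm x \<le> M" unfolding bounded_iff by blast
  then show ?thesis by (intro exI[of _ M]) (force simp: abs_le_iff)
qed

theorem theorem2p5: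
  fixes n :: nat and f g \<rho> :: "real \<Rightarrow> real"
    and a q \<alpha> \<beta> b :: real
  assumes n2: "n \<ge> 2"
    and f_cont: "continuous_on {0..} f"
    and f_C3: "Ck_on 3 {0<..} f"
    and f_pos: "\<And>u. u > 0 \<Longrightarrow> f u > 0"
    and f_exp: "\<And>u. u > 0 \<Longrightarrow> f u = exp (g u)"
    and g_def: "\<And>u. u > 0 \<Longrightarrow> g u = a * u powr q + \<rho> u"
    and a_pos: "a > 0"
    and q_gt: "1 < q" and q_le: "q \<le> real n / (real n - 1)"
    and \<rho>_C3: "Ck_on 3 {0<..} \<rho>"
    and \<alpha>_pos: "0 < \<alpha>" and \<alpha>_le: "\<alpha> \<le> 1" and \<beta>_pos: "0 < \<beta>"
    and f_zero: "(\<lambda>s. f s - f 0) \<in> O[at_right 0](\<lambda>s. s powr \<beta>)"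
    and f'_zero: "(\<lambda>s. deriv f s) \<in> O[at_right 0](\<lambda>s. s powr (\<alpha> - 1))"
    and H1: "\<And>k. k \<le> 3 \<Longrightarrow>
               ((\<lambda>x. (deriv ^^ k) \<rho> x / x powr (q - real k)) \<longlongrightarrow> 0) at_top"
    and H2: "Liminf at_top (\<lambda>x. ereal (g x - (real n - 1) / real n * x * deriv g x))
               \<ge> ereal b"
  shows "\<exists>\<gamma>\<^sub>0>0. \<exists>C. \<forall>\<gamma>>\<gamma>\<^sub>0. \<forall>y y' T. shooting_sol n f \<gamma> y y' T \<longrightarrow>
     (let g0 = g \<gamma>; g1 = deriv g \<gamma>; g2 = (deriv ^^ 2) g \<gamma>; \<delta> = ln g1;
          E = g0 - (real n - 1) / real n * \<gamma> * g1 in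
      \<bar>y' T - (real n / (real n - 1) * (1 / g1)
                + real n ^ 2 * harm n * g2 / ((real n - 1) * g1 ^ 3))\<bar>
        \<le> C * (\<delta> ^ 2 * g2 / g1 ^ 4 + exp (- E) / g1)
      \<and>
      \<bar>T - (E + (real n - 1) * ln ((real n - 1) / real n * g1)
                + harm n * (real n - 1) * \<gamma> * g2 / g1)\<bar>
        \<le> C * ((ln g1) ^ 2 / g1 + (ln g1) powr (\<beta> + 1) / g1 powr \<beta> + exp (- E)))"
proof -
  define m where "m = n - 1"
  have n_m: "n = Suc m" "m > 0" "real n - 1 = real m" using n2 by (auto simp: m_def)
  define G1 where "G1 = (\<lambda>u. a * q * u powr (q - 1) + deriv \<rho> u)"
  define G2 where "G2 = (\<lambda>u. a * q * (q - 1) * u powr (q - 2) + (deriv ^^ 2) \<rho> u)"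
  define G3 where "G3 = (\<lambda>u. a * q * (q - 1) * (q - 2) * u powr (q - 3) + (deriv ^^ 3) \<rho> u)"
  define g3 where "g3 = deriv ((deriv ^^ 2) g)"
  have r: "(\<rho> has_real_derivative deriv \<rho> u) (at u)"
      "(deriv \<rho> has_real_derivative (deriv ^^ 2) \<rho> u) (at u)"
      "((deriv ^^ 2) \<rho> has_real_derivative (deriv ^^ 3) \<rho> u) (at u)" if "u > 0" for u
    using Ck_on_deriv[OF \<rho>_C3, of 0 u] Ck_on_deriv[OF \<rho>_C3, of 1 u] Ck_on_deriv[OF \<rho>_C3, of 2 u] that
    by (simp_all add: eval_nat_numeral)
  have d0: "((\<lambda>u. a * u powr q + \<rho> u) has_real_derivative G1 u) (at u)" if "u > 0" for u
    unfolding G1_def by (intro DERIV_add powr_deriv_pos r that)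
  have d1: "(G1 has_real_derivative G2 u) (at u)" if "u > 0" for u
    using DERIV_add[OF powr_deriv_pos[OF that, of "a * q" "q - 1"] r(2)[OF that]]
    unfolding G1_def G2_def by (simp add: algebra_simps)
  have d2: "(G2 has_real_derivative G3 u) (at u)" if "u > 0" for u
    using DERIV_add[OF powr_deriv_pos[OF that, of "a * q * (q - 1)" "q - 2"] r(3)[OF that]]
    unfolding G2_def G3_def by (simp add: algebra_simps)
  have e0: "(g has_real_derivative G1 u) (at u)" "deriv g u = G1 u" if "u > 0" for u
    by (rule deriv_eq_on_pos[OF _ d0 that]; simp add: g_def)+
  have e1: "(deriv g has_real_derivative G2 u) (at u)" "deriv (deriv g) u = G2 u" if "u > 0" for u
    by (rule deriv_eq_on_pos[OF _ d1 that]; simp add: e0)+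
  have g2: "(deriv ^^ 2) g = deriv (deriv g)" by (simp add: numeral_2_eq_2)
  have e2: "((deriv ^^ 2) g has_real_derivative G3 u) (at u)" "deriv ((deriv ^^ 2) g) u = G3 u"
    if "u > 0" for u
    by (rule deriv_eq_on_pos[OF _ d2 that]; simp add: e1 g2)+
  have g_deriv: "(g has_real_derivative deriv g u) (at u)"
    and g1_deriv: "(deriv g has_real_derivative (deriv ^^ 2) g u) (at u)"
    and g2_deriv: "((deriv ^^ 2) g has_real_derivative g3 u) (at u)" if "u > 0" for u
    using e0[OF that] e1[OF that] e2[OF that] by (simp_all add: g2 g3_def)
  have lim: "((\<lambda>u. h u / u powr e) \<longlongrightarrow> c) at_top"
    if "\<And>u. u > 0 \<Longrightarrow> h u = c * u powr e + k u" "((\<lambda>u. k u / u powr e) \<longlongrightarrow> 0) at_top"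
    for h k :: "real \<Rightarrow> real" and c e :: real
  proof -
    have "((\<lambda>u. c + k u / u powr e) \<longlongrightarrow> c + 0) at_top" by (intro tendsto_intros that(2))
    moreover have "\<forall>\<^sub>F u in at_top. c + k u / u powr e = h u / u powr e"
      using eventually_gt_at_top[of 0] by eventually_elim (simp add: that(1) add_divide_distrib)
    ultimately show ?thesis by (simp add: tendsto_cong)
  qed
  have q2: "q \<le> 2"
  proof -
    have "real n / (real n - 1) \<le> 2" using n2 by (simp add: divide_le_eq)
    then show ?thesis using q_le by linarith
  qed
  interpret rg: regular_growth "deriv g" "(deriv ^^ 2) g" g3 q "a * q" "a * q * (q - 1)" "a * q * (q - 1) * (q - 2)"
  proof
    show "((\<lambda>u. deriv g u / u powr (q - 1)) \<longlongrightarrow> a * q) at_top"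
      by (rule lim[where k = "deriv \<rho>"]) (use e0(2) H1[of 1] in \<open>simp_all add: G1_def\<close>)
    show "((\<lambda>u. (deriv ^^ 2) g u / u powr (q - 2)) \<longlongrightarrow> a * q * (q - 1)) at_top"
      by (rule lim[where k = "(deriv ^^ 2) \<rho>"]) (use e1(2) H1[of 2] in \<open>simp_all add: G2_def g2\<close>)
    show "((\<lambda>u. g3 u / u powr (q - 3)) \<longlongrightarrow> a * q * (q - 1) * (q - 2)) at_top"
      by (rule lim[where k = "(deriv ^^ 3) \<rho>"]) (use e2(2) H1[of 3] in \<open>simp_all add: G3_def g3_def\<close>)
  qed (use a_pos q_gt q2 g2_deriv in auto)
  have "\<forall>\<^sub>F u in at_top. deriv g u \<ge> 0 \<and> (deriv ^^ 2) g u \<ge> 0"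
    using rg.g1_bounds rg.g2_lower eventually_gt_at_top[of 0]
  proof eventually_elim
    case (elim u)
    have "0 \<le> a * q / 2 * u powr (q - 1)" "0 \<le> a * q * (q - 1) / 2 * u powr (q - 2)"
      using a_pos q_gt by (simp_all add: mult_nonneg_nonneg)
    then show ?case using elim by linarith
  qed
  then obtain b0 where b0: "\<And>u. u \<ge> b0 \<Longrightarrow> deriv g u \<ge> 0 \<and> (deriv ^^ 2) g u \<ge> 0"
    unfolding eventually_at_top_linorder by blast
  \<comment> \<open>The maximum with \<open>1\<close> keeps \<open>u0\<close> positive, as the
    convexity argument and the exponential gain in \<open>u0 / p1\<close> require.\<close>
  define u0 where "u0 = max b0 1"
  have u0: "u0 > 0" "\<And>u. u \<ge> u0 \<Longrightarrow> deriv g u \<ge> 0" "\<And>u. u \<ge> u0 \<Longrightarrow> (deriv ^^ 2) g u \<ge> 0"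
    using b0 by (auto simp: u0_def)
  obtain M0 where M0: "\<And>u. 0 \<le> u \<Longrightarrow> u \<le> u0 \<Longrightarrow> f u \<le> M0"
    using continuous_on_bounded_above[OF f_cont, of u0] by blast
  obtain \<gamma>\<^sub>1 where \<gamma>1: "\<And>v. v \<ge> \<gamma>\<^sub>1 \<Longrightarrow> rg.regime (Suc m) u0 v"
    using rg.regime_eventually[OF _ u0(1), of "Suc m"] unfolding eventually_at_top_linorder by auto
  \<comment> \<open>Fixed before \<gamma> and the solution are introduced: the arguments of
    \<open>C_total\<close> mention neither.\<close>
  define C where "C = shooting_asymp.C_total m f u0 M0 rg.L rg.M2 rg.c2 (rg.Cx (Suc m))"
  show ?thesis
  proof (rule exI[of _ "max \<gamma>\<^sub>1 1"], rule conjI[rotated], rule exI[of _ C], intro allI impI)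
    fix \<gamma> T :: real and y p :: "real \<Rightarrow> real"
    assume \<gamma>: "max \<gamma>\<^sub>1 1 < \<gamma>" and sol: "shooting_sol n f \<gamma> y p T"
    define G where "G = deriv g \<gamma>"
    define \<Delta> where "\<Delta> = exp (- (g \<gamma> - (real n - 1) / real n * \<gamma> * G))"
    have "shooting m f g (deriv g) ((deriv ^^ 2) g) \<gamma> y p T"
      by unfold_locales (use n_m(2) \<gamma> sol[unfolded n_m(1)] f_cont f_exp g_deriv g1_deriv in auto)
    from rg.shooting_asymp_regime[OF this \<gamma>1 u0 M0] \<gamma>
    obtain t1 lo N X \<epsilon> \<eta> x where "shooting_asymp m f g (deriv g) ((deriv ^^ 2) g) \<gamma> y p T t1 lo N u0 M0
        rg.L rg.M2 rg.c2 (rg.Cx (Suc m)) (ln (deriv g \<gamma>)) X \<epsilon> \<eta> x" by auto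
    then interpret sa: shooting_asymp m f g "deriv g" "(deriv ^^ 2) g" \<gamma> y p T t1 lo N u0 M0
        rg.L rg.M2 rg.c2 "rg.Cx (Suc m)" "ln (deriv g \<gamma>)" X \<epsilon> \<eta> x .
    have C: "C \<ge> 0" unfolding C_def by (rule sa.C_total_nonneg)
    note p = sa.p_expansion[folded C_def, folded n_m(1), folded n_m(3), folded G_def, folded \<Delta>_def]
    \<comment> \<open>Adding this nonnegative term to the error only enlarges the bound.\<close>
    have "(ln G) powr (\<beta> + 1) / G powr \<beta> \<ge> 0" by simp
    then have "C * ((ln G)\<^sup>2 / G + \<Delta>) \<le> C * ((ln G)\<^sup>2 / G + (ln G) powr (\<beta> + 1) / G powr \<beta> + \<Delta>)"
      using C by (intro mult_left_mono) auto
    with sa.T_expansion[folded C_def, folded n_m(1), folded n_m(3), folded G_def, folded \<Delta>_def]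
    have "\<bar>T - ((g \<gamma> - (real n - 1) / real n * \<gamma> * G) + (real n - 1) * ln ((real n - 1) / real n * G)
        + harm n * (real n - 1) * \<gamma> * (deriv ^^ 2) g \<gamma> / G)\<bar>
      \<le> C * ((ln G)\<^sup>2 / G + (ln G) powr (\<beta> + 1) / G powr \<beta> + \<Delta>)" by (rule order_trans)
    with p show "let g0 = g \<gamma>; g1 = deriv g \<gamma>; g2 = (deriv ^^ 2) g \<gamma>; \<delta> = ln g1;
          E = g0 - (real n - 1) / real n * \<gamma> * g1 in
      \<bar>p T - (real n / (real n - 1) * (1 / g1)
                + real n ^ 2 * harm n * g2 / ((real n - 1) * g1 ^ 3))\<bar>
        \<le> C * (\<delta> ^ 2 * g2 / g1 ^ 4 + exp (- E) / g1)
      \<and>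
      \<bar>T - (E + (real n - 1) * ln ((real n - 1) / real n * g1)
                + harm n * (real n - 1) * \<gamma> * g2 / g1)\<bar>
        \<le> C * ((ln g1) ^ 2 / g1 + (ln g1) powr (\<beta> + 1) / g1 powr \<beta> + exp (- E))"
      unfolding Let_def G_def[symmetric] \<Delta>_def[symmetric] by blast
  qed simp
qed

end
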